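(* Let $G$ be a finite abelian group, $H\subseteq G$ a subgroup, and $G/H=\{k_1,\dots,k_m\}$ its cosets. Let $E\subseteq G$ multi-tile $G$ with partner $H$ at level $\ell$, i.e. $F_i:=E\cap k_i$ has $|F_i|=\ell$ for all $i$; choose $g_i\in k_i$ and set $F_i'=F_i-g_i\subseteq H$. Let $B_H\subseteq\widehat H$ have $\ell$ elements; for each $\phi\in B_H$ choose $\widetilde\phi\in\widehat G$ whose restriction to $H$ is $\phi$, and let $B=\{\widetilde\phi\,\psi:\phi\in B_H,\ \psi\in H^\perp\}\subseteq\widehat G$. Then for $\widetilde Q=\widetilde L$ or $\widetilde Q=\widetilde U$, $$\widetilde Q_E(B)=\max_{1\le i\le m}\widetilde Q_{F_i'}(B_H);$$ moreover $$\rho_E(B)=\max_{1\le i\le m}\widetilde L_{F_i'}(B_H)\cdot\max_{1\le i\le m}\widetilde U_{F_i'}(B_H)\ \ge\ \max_{1\le i\le m}\rho_{F_i'}(B_H),$$ and $$\widetilde D_E(B)=\Big(\prod_{i=1}^m\widetilde D_{F_i'}(B_H)\Big)^{1/m}.$$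
   Context: $\widehat\Gamma$ denotes the group of characters $\Gamma\to\mathbb{S}^1$ of a finite abelian group $\Gamma$; $H^\perp=\{\psi\in\widehat G:\psi|_H\equiv1\}$. For nonempty $E=\{x_1,\dots,x_n\}\subseteq\Gamma$ and $B=\{b_1,\dots,b_n\}\subseteq\widehat\Gamma$, $T(E,B)$ is the $n\times n$ matrix with $(i,j)$ entry $b_j(x_i)$. $L_E(B)=\sigma_{\min}(T)^2$, $U_E(B)=\|T\|^2$ (operator $2$-norm), $\rho_E(B)=U_E(B)/L_E(B)$, $D_E(B)=|\det T|$; normalized: $\widetilde L_E(B)=n/L_E(B)$, $\widetilde U_E(B)=U_E(B)/n$, $\widetilde D_E(B)=\sqrt n/D_E(B)^{1/n}$ (with value $\infty$ when $T$ is singular where applicable). Quantities for $(F_i',B_H)$ are computed in $H$; they do not depend on the choice of $g_i$. *)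

theory Defs
  imports
    "HOL-Algebra.Coset"
    "HOL-Library.Extended_Nonnegative_Real"
    "HOL-Analysis.L2_Norm"
    "Jordan_Normal_Form.Schur_Decomposition"
    "Jordan_Normal_Form.Determinant"
begin

definition circle_group :: "complex monoid" where
  "circle_group = \<lparr>carrier = {z. cmod z = 1}, monoid.mult = (*), one = 1\<rparr>"

text \<open>Characters are taken extensional (equal to \<open>undefined\<close> off the carrier), so that
  distinct functions are distinct characters and sets of characters have the right cardinality.\<close>

definition characters :: "('a, 'b) monoid_scheme \<Rightarrow> ('a \<Rightarrow> complex) set" where
  "characters \<Gamma> = hom \<Gamma> circle_group \<inter> extensional (carrier \<Gamma>)"

definition char_mult ::
  "('a, 'b) monoid_scheme \<Rightarrow> ('a \<Rightarrow> complex) \<Rightarrow> ('a \<Rightarrow> complex) \<Rightarrow> 'a \<Rightarrow> complex" where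
  "char_mult \<Gamma> \<phi> \<psi> = (\<lambda>x\<in>carrier \<Gamma>. \<phi> x * \<psi> x)"

definition annihilator :: "('a, 'b) monoid_scheme \<Rightarrow> 'a set \<Rightarrow> ('a \<Rightarrow> complex) set" where
  "annihilator G H = {\<psi> \<in> characters G. \<forall>h\<in>H. \<psi> h = 1}"

definition vec_norm2 :: "complex vec \<Rightarrow> real" where
  "vec_norm2 v = L2_set (\<lambda>i. cmod (v $ i)) {..<dim_vec v}"

definition op_norm2 :: "complex mat \<Rightarrow> real" where
  "op_norm2 A = Sup {vec_norm2 (A *\<^sub>v v) | v. v \<in> carrier_vec (dim_col A) \<and> vec_norm2 v = 1}"

text \<open>For a square matrix: the nonnegative square roots of the eigenvalues of \<open>A\<^sup>* A\<close>.\<close>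

definition singular_values :: "complex mat \<Rightarrow> real set" where
  "singular_values A = {s. 0 \<le> s \<and> eigenvalue (mat_adjoint A * A) (complex_of_real (s\<^sup>2))}"

definition sigma_min :: "complex mat \<Rightarrow> real" where
  "sigma_min A = Min (singular_values A)"

definition enumerates :: "'a list \<Rightarrow> 'a set \<Rightarrow> bool" where
  "enumerates xs A \<longleftrightarrow> distinct xs \<and> set xs = A"

text \<open>The matrix \<open>T(E,B)\<close> and the quantities derived from it are functions of enumerations
  \<open>xs\<close> of \<open>E\<close> and \<open>bs\<close> of \<open>B\<close>.\<close>

definition char_mat :: "'a list \<Rightarrow> ('a \<Rightarrow> complex) list \<Rightarrow> complex mat" where
  "char_mat xs bs = mat (length xs) (length bs) (\<lambda>(i, j). (bs ! j) (xs ! i))"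

definition Lq :: "'a list \<Rightarrow> ('a \<Rightarrow> complex) list \<Rightarrow> real" where
  "Lq xs bs = (sigma_min (char_mat xs bs))\<^sup>2"

definition Uq :: "'a list \<Rightarrow> ('a \<Rightarrow> complex) list \<Rightarrow> real" where
  "Uq xs bs = (op_norm2 (char_mat xs bs))\<^sup>2"

definition Dq :: "'a list \<Rightarrow> ('a \<Rightarrow> complex) list \<Rightarrow> real" where
  "Dq xs bs = cmod (det (char_mat xs bs))"

text \<open>In \<^typ>\<open>ennreal\<close> a positive number divided by \<open>0\<close> is \<open>\<infinity>\<close>, which is the convention for
  singular \<open>T\<close>.\<close>

definition rho :: "'a list \<Rightarrow> ('a \<Rightarrow> complex) list \<Rightarrow> ennreal" where
  "rho xs bs = ennreal (Uq xs bs) / ennreal (Lq xs bs)"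

definition L_norm :: "'a list \<Rightarrow> ('a \<Rightarrow> complex) list \<Rightarrow> ennreal" where
  "L_norm xs bs = ennreal (real (length xs)) / ennreal (Lq xs bs)"

definition U_norm :: "'a list \<Rightarrow> ('a \<Rightarrow> complex) list \<Rightarrow> ennreal" where
  "U_norm xs bs = ennreal (Uq xs bs) / ennreal (real (length xs))"

definition D_norm :: "'a list \<Rightarrow> ('a \<Rightarrow> complex) list \<Rightarrow> ennreal" where
  "D_norm xs bs = ennreal (sqrt (real (length xs))) / ennreal (root (length xs) (Dq xs bs))"

definition ennreal_root :: "nat \<Rightarrow> ennreal \<Rightarrow> ennreal" where
  "ennreal_root m x = (if x = \<infinity> then \<infinity> else ennreal (root m (enn2real x)))"

end

theory Submission
  imports
    Defs
    "HOL-Algebra.Multiplicative_Group"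
    "Jordan_Normal_Form.Spectral_Radius"
begin

text \<open>
  For \<open>x = f g\<^sub>i\<close> with \<open>f \<in> F'\<^sub>i\<close> and \<open>b \<in> B\<close> one has \<open>b x = \<phi> f \<cdot> b g\<^sub>i\<close>, where \<open>\<phi> = b|\<^sub>H \<in> B\<^sub>H\<close>.
  Hence, up to a permutation of its rows, \<open>T(E, B)\<close> is the product of the block diagonal matrix
  with blocks \<open>T(F'\<^sub>i, B\<^sub>H)\<close> and the matrix \<open>V\<close> with entries \<open>V((i, \<phi>), b) = b g\<^sub>i\<close> if \<open>b|\<^sub>H = \<phi>\<close> and
  \<open>0\<close> otherwise. Orthogonality of the characters in \<open>H\<^sup>\<bottom>\<close> on the cosets gives \<open>V\<^sup>* V = m I\<close>; that \<open>V\<close> is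
  square amounts to \<open>|H\<^sup>\<bottom>| = m\<close>, which follows because characters extend from subgroups.
  So \<open>T(E, B)\<close> has the singular values of all the blocks, multiplied by \<open>\<surd>m\<close>.
\<close>

section \<open>Characters of finite abelian groups\<close>

text \<open>The size of the annihilator comes from double counting the sum of \<psi>(x) over \<psi>
  trivial on \<open>H\<close> and x in \<open>G\<close>. This needs, for each x outside
  \<open>H\<close>, such a \<psi> with \<psi>(x) \<noteq> 1; hence characters are extended from a
  subgroup with a prescribed value at x. The columns of \<open>V\<close> are orthogonal for two
  different reasons: members of \<open>B\<close> with different restrictions to \<open>H\<close>
  give columns with disjoint supports, and members with the same restriction differ by a factor in
  the annihilator, whose sum over coset representatives vanishes. Singular values are defined by
  eigenvalues of the Gram matrix and the operator norm by a supremum, and the proof never relates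
  the two. The factorization is therefore carried through each definition separately: by similarity
  and characteristic polynomials for the former, by comparing upper bounds for the latter. The
  factor m is the ratio of |E| = ml to the block size l, so the normalizations absorb it. Blocks may
  be singular, which is why zero denominators are treated separately in
  \<open>ennreal\<close>.\<close>

lemma exists_unit_root:
  fixes w :: complex
  assumes "cmod w = 1" and "0 < n"
  shows "\<exists>z. z ^ n = w \<and> cmod z = 1"
proof -
  have "cis (Arg w / real n) ^ n = cis (Arg w)"
    using assms by (simp add: DeMoivre)
  also have "\<dots> = w"
    using assms cis_Arg[of w] by (force simp: sgn_eq)
  finally show ?thesis
    by (intro exI[of _ "cis (Arg w / real n)"]) simp
qed

lemma exists_nontrivial_root_of_unity:
  assumes "1 < n"
  shows "\<exists>z :: complex. z ^ n = 1 \<and> cmod z = 1 \<and> z \<noteq> 1"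
proof -
  have "card {z :: complex. z ^ n = 1} = n"
    using assms by (simp add: card_roots_unity_eq)
  then have "\<not> {z :: complex. z ^ n = 1} \<subseteq> {1}"
    using assms card_mono[of "{1 :: complex}" "{z. z ^ n = 1}"] by auto
  then obtain z :: complex where z: "z ^ n = 1" "z \<noteq> 1" by blast
  have "cmod z ^ n = 1"
    using z by (metis norm_one norm_power)
  then have "cmod z = 1"
    using assms power_eq_imp_eq_base[of "cmod z" n 1] by simp
  with z show ?thesis by blast
qed

section \<open>Characters of subgroups and their extension\<close>

lemma hom_circle_iff:
  "\<chi> \<in> hom (G\<lparr>carrier := K\<rparr>) circle_group \<longleftrightarrow>
     (\<forall>a\<in>K. cmod (\<chi> a) = 1) \<and> (\<forall>a\<in>K. \<forall>b\<in>K. \<chi> (a \<otimes>\<^bsub>G\<^esub> b) = \<chi> a * \<chi> b)"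
  by (auto simp: hom_def circle_group_def)

lemma charactersD:
  assumes "\<chi> \<in> characters G"
  shows "a \<in> carrier G \<Longrightarrow> cmod (\<chi> a) = 1"
    and "a \<in> carrier G \<Longrightarrow> b \<in> carrier G \<Longrightarrow> \<chi> (a \<otimes>\<^bsub>G\<^esub> b) = \<chi> a * \<chi> b"
    and "\<chi> \<in> extensional (carrier G)"
  using assms by (auto simp: characters_def hom_def circle_group_def)

lemma charactersI:
  assumes "\<And>a. a \<in> carrier G \<Longrightarrow> cmod (\<chi> a) = 1"
    and "\<And>a b. a \<in> carrier G \<Longrightarrow> b \<in> carrier G \<Longrightarrow> \<chi> (a \<otimes>\<^bsub>G\<^esub> b) = \<chi> a * \<chi> b"
    and "\<chi> \<in> extensional (carrier G)"
  shows "\<chi> \<in> characters G"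
  using assms by (auto simp: characters_def hom_def circle_group_def)

lemma unit_cnj_mult:
  assumes "cmod z = 1"
  shows "cnj z * z = 1" and "z * cnj z = 1"
  using assms by (simp_all add: complex_norm_square[symmetric] mult.commute)

context comm_group
begin

lemma hom_circle_one:
  assumes "subgroup K G" "\<chi> \<in> hom (G\<lparr>carrier := K\<rparr>) circle_group"
  shows "\<chi> \<one> = 1"
proof -
  have "\<one> \<in> K" using assms(1) by (rule subgroup.one_closed)
  then have "cmod (\<chi> \<one>) = 1" "\<chi> (\<one> \<otimes> \<one>) = \<chi> \<one> * \<chi> \<one>"
    using assms(2) unfolding hom_circle_iff by blast+
  then show ?thesis by auto
qed

lemma hom_circle_pow:
  assumes K: "subgroup K G" and \<chi>: "\<chi> \<in> hom (G\<lparr>carrier := K\<rparr>) circle_group" and "a \<in> K"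
  shows "a [^] (q::nat) \<in> K \<and> \<chi> (a [^] q) = \<chi> a ^ q"
proof (induction q)
  case 0
  then show ?case using hom_circle_one[OF K \<chi>] subgroup.one_closed[OF K] by simp
next
  case (Suc q)
  then show ?case
    using \<chi> \<open>a \<in> K\<close> subgroup.m_closed[OF K] unfolding hom_circle_iff by (simp add: mult.commute)
qed

text \<open>On the subgroup generated by \<open>K\<close> and \<open>x\<close> the extension has to
  be \<open>a \<otimes> x [^] j \<mapsto> \<chi> a * z ^ j\<close>. All coincidences between such
  products come from powers of \<open>x\<close> lying in \<open>K\<close>, hence from
  \<open>x [^] n\<close>, so \<open>z ^ n = \<chi> (x [^] n)\<close> is the only condition on
  \<open>z\<close>. The freedom in \<open>z\<close> is kept: any root serves for extending, a root
  other than 1 for separating points.\<close>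

lemma extend_hom_circle_step:
  assumes fin: "finite (carrier G)" and K: "subgroup K G"
    and \<chi>: "\<chi> \<in> hom (G\<lparr>carrier := K\<rparr>) circle_group"
    and x: "x \<in> carrier G"
    and n: "0 < n" "x [^] n \<in> K" "\<And>j. 0 < j \<Longrightarrow> x [^] (j::nat) \<in> K \<Longrightarrow> n \<le> j"
    and z: "z ^ n = \<chi> (x [^] n)" "cmod z = 1"
  shows "\<exists>K' \<chi>'. subgroup K' G \<and> K \<subseteq> K' \<and> x \<in> K' \<and>
    \<chi>' \<in> hom (G\<lparr>carrier := K'\<rparr>) circle_group \<and> (\<forall>a\<in>K. \<chi>' a = \<chi> a) \<and> \<chi>' x = z"
proof -
  define K' where "K' = K <#> generate G {x}"
  \<comment> \<open>In a finite group the natural powers of \<open>x\<close> already form the cyclic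
    subgroup, so negative exponents never occur.\<close>
  have K'_iff: "y \<in> K' \<longleftrightarrow> (\<exists>a\<in>K. \<exists>j::nat. y = a \<otimes> x [^] j)" for y
    unfolding K'_def generate_pow_on_finite_carrier[OF fin x] set_mult_def by blast
  have sub: "subgroup K' G"
    unfolding K'_def using K x by (intro mult_subgroups generate_is_subgroup) auto
  have Kc: "a \<in> carrier G" if "a \<in> K" for a
    using subgroup.mem_carrier[OF K that] .
  have \<chi>m: "\<chi> (a \<otimes> b) = \<chi> a * \<chi> b" if "a \<in> K" "b \<in> K" for a b
    using \<chi> that unfolding hom_circle_iff by blast
  have pow: "\<chi> (x [^] d) = z ^ d" if d: "x [^] d \<in> K" for d :: nat
  proof -
    \<comment> \<open>Division with remainder: \<open>x [^] (d mod n)\<close> lies in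
      \<open>K\<close> as well, and minimality of \<open>n\<close> forces the remainder to be
      0.\<close>
    have split: "x [^] d = (x [^] n) [^] (d div n) \<otimes> x [^] (d mod n)"
      using x by (simp add: nat_pow_pow nat_pow_mult)
    have q: "(x [^] n) [^] (d div n) \<in> K" "\<chi> ((x [^] n) [^] (d div n)) = z ^ (n * (d div n))"
      using hom_circle_pow[OF K \<chi> n(2)] z by (auto simp: power_mult)
    have "x [^] (d mod n) = inv ((x [^] n) [^] (d div n)) \<otimes> x [^] d"
      unfolding split using x Kc[OF q(1)] by (simp add: m_assoc[symmetric])
    then have "x [^] (d mod n) \<in> K"
      using d q(1) K by (simp add: subgroup.m_closed subgroup.m_inv_closed)
    then have "d mod n = 0"
      using n(1) n(3)[of "d mod n"] by (metis mod_less_divisor not_gr_zero leD)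
    then have "d = n * (d div n)" "x [^] d = (x [^] n) [^] (d div n)"
      using split x by auto
    then show ?thesis using q(2) by metis
  qed
  \<comment> \<open>Ordering the exponents keeps \<open>j - i\<close> a natural number. Cancelling
    \<open>x [^] i\<close> puts \<open>x [^] (j - i)\<close> into \<open>K\<close>, where
    \<open>pow\<close> applies.\<close>
  have wd_le: "\<chi> a * z ^ i = \<chi> b * z ^ j"
    if "a \<in> K" "b \<in> K" "a \<otimes> x [^] i = b \<otimes> x [^] j" "i \<le> j" for a b and i j :: nat
  proof -
    have "b \<otimes> x [^] j = (b \<otimes> x [^] (j - i)) \<otimes> x [^] i"
      using that(4) x Kc[OF that(2)] by (simp add: m_assoc nat_pow_mult)
    then have a: "a = b \<otimes> x [^] (j - i)"
      using that(3) x Kc[OF that(1)] Kc[OF that(2)]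
      by (metis m_closed nat_pow_closed right_cancel)
    then have "x [^] (j - i) = inv b \<otimes> a"
      using x Kc[OF that(2)] by (simp add: m_assoc[symmetric])
    then have "x [^] (j - i) \<in> K"
      using that K by (simp add: subgroup.m_closed subgroup.m_inv_closed)
    with a have "\<chi> a = \<chi> b * z ^ (j - i)"
      using \<chi>m that(2) pow by simp
    then show ?thesis using that(4) by (simp add: power_add[symmetric] mult.assoc)
  qed
  have wd: "\<chi> a * z ^ i = \<chi> b * z ^ j"
    if "a \<in> K" "b \<in> K" "a \<otimes> x [^] i = b \<otimes> x [^] j" for a b and i j :: nat
    using wd_le[OF that] wd_le[OF that(2,1) that(3)[symmetric]] nat_le_linear[of i j] by auto
  \<comment> \<open>The choice is among the values given by all representations of \<open>y\<close>;
    by \<open>wd\<close> there is at most one.\<close>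
  define \<chi>' where "\<chi>' y = (SOME c. \<exists>a\<in>K. \<exists>j::nat. y = a \<otimes> x [^] j \<and> c = \<chi> a * z ^ j)" for y
  have \<chi>'_eq: "\<chi>' (a \<otimes> x [^] j) = \<chi> a * z ^ j" if "a \<in> K" for a and j :: nat
  proof -
    have "\<exists>c. \<exists>b\<in>K. \<exists>i::nat. a \<otimes> x [^] j = b \<otimes> x [^] i \<and> c = \<chi> b * z ^ i"
      using that by blast
    from someI_ex[OF this] obtain b i where "b \<in> K" "a \<otimes> x [^] j = b \<otimes> x [^] i"
      "\<chi>' (a \<otimes> x [^] j) = \<chi> b * z ^ (i::nat)"
      unfolding \<chi>'_def by blast
    then show ?thesis using wd[OF that, of b j i] by simp
  qed
  have one: "\<one> \<in> K" using K by (rule subgroup.one_closed)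
  have onK: "a \<in> K' \<and> \<chi>' a = \<chi> a" if "a \<in> K" for a
    using \<chi>'_eq[OF that, of 0] Kc[OF that] that unfolding K'_iff
    by (auto intro!: bexI[of _ a] exI[of _ "0::nat"])
  have atx: "x \<in> K' \<and> \<chi>' x = z"
    using \<chi>'_eq[OF one, of 1] x hom_circle_one[OF K \<chi>] one unfolding K'_iff
    by (auto intro!: bexI[of _ \<one>] exI[of _ "1::nat"])
  have "\<chi>' \<in> hom (G\<lparr>carrier := K'\<rparr>) circle_group"
    unfolding hom_circle_iff
  proof (intro conjI ballI)
    fix a assume "a \<in> K'"
    then show "cmod (\<chi>' a) = 1"
      using \<chi> z(2) unfolding K'_iff hom_circle_iff
      by (auto simp: \<chi>'_eq norm_mult norm_power)
  next
    fix a b assume "a \<in> K'" "b \<in> K'"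
    then obtain a' b' and i j :: nat where a: "a' \<in> K" "a = a' \<otimes> x [^] i"
      and b: "b' \<in> K" "b = b' \<otimes> x [^] j" unfolding K'_iff by blast
    have "a \<otimes> b = (a' \<otimes> b') \<otimes> x [^] (i + j)"
      using a b x Kc by (simp add: nat_pow_mult[symmetric] m_ac)
    moreover have "a' \<otimes> b' \<in> K" using a b K by (simp add: subgroup.m_closed)
    ultimately show "\<chi>' (a \<otimes> b) = \<chi>' a * \<chi>' b"
      using a b by (simp add: \<chi>'_eq \<chi>m power_add)
  qed
  then show ?thesis using sub onK atx by blast
qed

text \<open>Some exponent exists because \<open>x\<close> to the order of \<open>G\<close> is
  \<open>\<one>\<close>. The least one is the order of the coset of \<open>x\<close> in the quotient
  by \<open>K\<close>.\<close>

lemma exists_least_pow_mem: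
  assumes "finite (carrier G)" "subgroup K G" "x \<in> carrier G"
  obtains n :: nat where "0 < n" "x [^] n \<in> K" "\<And>j. 0 < j \<Longrightarrow> x [^] (j::nat) \<in> K \<Longrightarrow> n \<le> j"
proof -
  let ?P = "\<lambda>j::nat. 0 < j \<and> x [^] j \<in> K"
  have "?P (Coset.order G)"
    using assms pow_order_eq_1[OF assms(3)] order_gt_0_iff_finite
    by (simp add: subgroup.one_closed)
  then have "?P (LEAST j. ?P j)" by (rule LeastI)
  moreover have "(LEAST j. ?P j) \<le> j" if "0 < j" "x [^] j \<in> K" for j
    using that by (intro Least_le) simp
  ultimately show ?thesis using that by blast
qed

text \<open>The circle is divisible, so one element can always be adjoined; induction on the number
  of elements outside \<open>K\<close> then exhausts the finite group.\<close>

lemma extend_hom_circle: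
  assumes fin: "finite (carrier G)"
  shows "subgroup K G \<Longrightarrow> \<chi> \<in> hom (G\<lparr>carrier := K\<rparr>) circle_group \<Longrightarrow>
    \<exists>\<chi>'. \<chi>' \<in> characters G \<and> (\<forall>a\<in>K. \<chi>' a = \<chi> a)"
proof (induction "card (carrier G - K)" arbitrary: K \<chi> rule: less_induct)
  case less
  note K = less.prems(1) and \<chi> = less.prems(2)
  have sub: "K \<subseteq> carrier G" using K by (rule subgroup.subset)
  show ?case
  proof (cases "K = carrier G")
    case True
    \<comment> \<open>Intermediate homomorphisms are arbitrary off their domain; only here is the
      result made extensional.\<close>
    have "restrict \<chi> (carrier G) \<in> characters G"
      using \<chi> unfolding True hom_circle_iff by (intro charactersI) auto
    then show ?thesis using True by (intro exI[of _ "restrict \<chi> (carrier G)"]) auto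
  next
    case False
    then obtain x where x: "x \<in> carrier G" "x \<notin> K" using sub by blast
    obtain n :: nat where n: "0 < n" "x [^] n \<in> K"
      "\<And>j. 0 < j \<Longrightarrow> x [^] (j::nat) \<in> K \<Longrightarrow> n \<le> j"
      using exists_least_pow_mem[OF fin K x(1)] by blast
    have "cmod (\<chi> (x [^] n)) = 1" using \<chi> n(2) unfolding hom_circle_iff by blast
    then obtain z where "z ^ n = \<chi> (x [^] n)" "cmod z = 1"
      using exists_unit_root n(1) by blast
    from extend_hom_circle_step[OF fin K \<chi> x(1) n this]
    obtain K' \<chi>' where K': "subgroup K' G" "K \<subseteq> K'" "x \<in> K'"
      "\<chi>' \<in> hom (G\<lparr>carrier := K'\<rparr>) circle_group" "\<forall>a\<in>K. \<chi>' a = \<chi> a"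
      by blast
    have "card (carrier G - K') < card (carrier G - K)"
      using fin x K'(2,3) by (intro psubset_card_mono) auto
    from less.hyps[OF this K'(1,4)] K'(2,5) show ?thesis
      by (metis subsetD)
  qed
qed

text \<open>If \<open>x \<notin> H\<close>, the least \<open>n\<close> with
  \<open>x [^] n \<in> H\<close> exceeds 1, so there is an \<open>n\<close>-th root of unity
  \<open>z \<noteq> 1\<close>. The trivial character of \<open>H\<close> extends with value
  \<open>z\<close> at \<open>x\<close>, and then to all of \<open>G\<close>.\<close>

lemma annihilator_separates:
  assumes fin: "finite (carrier G)" and H: "subgroup H G" and x: "x \<in> carrier G" "x \<notin> H"
  shows "\<exists>\<psi>\<in>annihilator G H. \<psi> x \<noteq> 1"
proof -
  obtain n :: nat where n: "0 < n" "x [^] n \<in> H"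
    "\<And>j. 0 < j \<Longrightarrow> x [^] (j::nat) \<in> H \<Longrightarrow> n \<le> j"
    using exists_least_pow_mem[OF fin H x(1)] by blast
  have "n \<noteq> 1" using n(2) x by auto
  then obtain z :: complex where z: "z ^ n = 1" "cmod z = 1" "z \<noteq> 1"
    using exists_nontrivial_root_of_unity[of n] n(1) by auto
  have "(\<lambda>_. 1) \<in> hom (G\<lparr>carrier := H\<rparr>) circle_group"
    unfolding hom_circle_iff by simp
  from extend_hom_circle_step[OF fin H this x(1) n z(1,2)]
  obtain K \<chi> where K: "subgroup K G" "H \<subseteq> K" "x \<in> K"
    "\<chi> \<in> hom (G\<lparr>carrier := K\<rparr>) circle_group" "\<forall>a\<in>H. \<chi> a = 1" "\<chi> x = z"
    by auto
  from extend_hom_circle[OF fin K(1,4)]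
  obtain \<psi> where "\<psi> \<in> characters G" "\<forall>a\<in>K. \<psi> a = \<chi> a" by blast
  then have "\<psi> \<in> annihilator G H" "\<psi> x \<noteq> 1"
    using K z(3) unfolding annihilator_def by auto
  then show ?thesis by blast
qed

section \<open>Orthogonality relations and the size of the annihilator\<close>

lemma character_one: "\<chi> \<in> characters G \<Longrightarrow> \<chi> \<one> = 1"
  using hom_circle_one[OF subgroup_self, of \<chi>] by (simp add: characters_def)

text \<open>All values are roots of unity of degree the order of \<open>G\<close>, and
  extensionality leaves no freedom off the carrier. Sums over the annihilator thus range over a
  finite set.\<close>

lemma finite_characters:
  assumes fin: "finite (carrier G)"
  shows "finite (characters G)"
proof (rule finite_subset)
  have o: "0 < Coset.order G" using fin order_gt_0_iff_finite by blast
  show "finite (carrier G \<rightarrow>\<^sub>E {z :: complex. z ^ Coset.order G = 1})"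
    using fin o by (intro finite_PiE finite_roots_unity) auto
  show "characters G \<subseteq> carrier G \<rightarrow>\<^sub>E {z. z ^ Coset.order G = 1}"
  proof
    fix \<chi> assume \<chi>: "\<chi> \<in> characters G"
    have "\<chi> a ^ Coset.order G = 1" if "a \<in> carrier G" for a
      using hom_circle_pow[OF subgroup_self, of \<chi> a "Coset.order G"] \<chi> that
        pow_order_eq_1[OF that] character_one[OF \<chi>]
      by (simp add: characters_def)
    then show "\<chi> \<in> carrier G \<rightarrow>\<^sub>E {z. z ^ Coset.order G = 1}"
      using charactersD(3)[OF \<chi>] by (auto simp: PiE_iff)
  qed
qed

text \<open>Translation by \<open>a\<close> permutes the group and multiplies the sum by
  \<open>\<chi> a \<noteq> 1\<close>.\<close>

lemma sum_character:
  assumes \<chi>: "\<chi> \<in> characters G" and a: "a \<in> carrier G" "\<chi> a \<noteq> 1"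
  shows "(\<Sum>x\<in>carrier G. \<chi> x) = 0"
proof -
  have "(\<Sum>x\<in>carrier G. \<chi> x) = (\<Sum>x\<in>carrier G. \<chi> (a \<otimes> x))"
    by (rule sum.reindex_bij_witness[where i = "\<lambda>x. a \<otimes> x" and j = "\<lambda>x. inv a \<otimes> x"])
       (use a in \<open>auto simp: m_assoc[symmetric]\<close>)
  also have "\<dots> = \<chi> a * (\<Sum>x\<in>carrier G. \<chi> x)"
    using charactersD(2)[OF \<chi> a(1)] by (simp add: sum_distrib_left)
  finally have "(1 - \<chi> a) * (\<Sum>x\<in>carrier G. \<chi> x) = 0" by (simp add: algebra_simps)
  then show ?thesis using a by simp
qed

lemma char_mult_characters:
  "\<phi> \<in> characters G \<Longrightarrow> \<psi> \<in> characters G \<Longrightarrow> char_mult G \<phi> \<psi> \<in> characters G"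
  by (rule charactersI) (auto simp: char_mult_def charactersD norm_mult)

text \<open>The inverse in the character group, since the values have modulus 1.\<close>

definition char_cnj :: "('a \<Rightarrow> complex) \<Rightarrow> 'a \<Rightarrow> complex" where
  "char_cnj \<phi> = (\<lambda>x\<in>carrier G. cnj (\<phi> x))"

lemma char_cnj_characters: "\<phi> \<in> characters G \<Longrightarrow> char_cnj \<phi> \<in> characters G"
  by (rule charactersI) (auto simp: char_cnj_def charactersD)

lemma char_mult_apply: "x \<in> carrier G \<Longrightarrow> char_mult G \<phi> \<psi> x = \<phi> x * \<psi> x"
  by (simp add: char_mult_def)

lemma char_cnj_apply: "x \<in> carrier G \<Longrightarrow> char_cnj \<phi> x = cnj (\<phi> x)"
  by (simp add: char_cnj_def)

text \<open>These cancellations make multiplication by \<open>\<phi>\<close> a bijection of the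
  characters, which is all of the dual group structure that the reindexings require.\<close>

lemma char_mult_cnj_cancel:
  assumes "\<phi> \<in> characters G" "\<psi> \<in> characters G"
  shows "char_mult G \<phi> (char_mult G (char_cnj \<phi>) \<psi>) = \<psi>"
    and "char_mult G (char_cnj \<phi>) (char_mult G \<phi> \<psi>) = \<psi>"
  using charactersD(3)[OF assms(2)] unit_cnj_mult[OF charactersD(1)[OF assms(1)]]
  by (auto simp: char_mult_def char_cnj_def fun_eq_iff mult.assoc[symmetric] extensional_def)

text \<open>Dual to \<open>sum_character\<close>: multiplication by a separating
  \<open>\<chi>\<close> permutes the annihilator and multiplies the sum by
  \<open>\<chi> x \<noteq> 1\<close>.\<close>

lemma sum_annihilator:
  assumes fin: "finite (carrier G)" and H: "subgroup H G" and x: "x \<in> carrier G" "x \<notin> H"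
  shows "(\<Sum>\<psi>\<in>annihilator G H. \<psi> x) = 0"
proof -
  obtain \<chi> where \<chi>: "\<chi> \<in> annihilator G H" "\<chi> x \<noteq> 1"
    using annihilator_separates[OF assms] by blast
  have \<chi>': "\<chi> \<in> characters G" "\<forall>h\<in>H. \<chi> h = 1" using \<chi>(1) by (auto simp: annihilator_def)
  have Hc: "h \<in> carrier G" if "h \<in> H" for h using subgroup.mem_carrier[OF H that] .
  have "(\<Sum>\<psi>\<in>annihilator G H. \<psi> x) = (\<Sum>\<psi>\<in>annihilator G H. char_mult G \<chi> \<psi> x)"
    by (rule sum.reindex_bij_witness[where i = "char_mult G \<chi>" and j = "char_mult G (char_cnj \<chi>)"])
       (use \<chi>' Hc in \<open>auto simp: annihilator_def char_mult_cnj_cancel char_mult_characters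
          char_cnj_characters char_mult_apply char_cnj_apply\<close>)
  also have "\<dots> = \<chi> x * (\<Sum>\<psi>\<in>annihilator G H. \<psi> x)"
    using x by (simp add: sum_distrib_left char_mult_def)
  finally have "(1 - \<chi> x) * (\<Sum>\<psi>\<in>annihilator G H. \<psi> x) = 0" by (simp add: algebra_simps)
  then show ?thesis using \<chi>(2) by simp
qed

text \<open>The sum of \<open>\<psi> x\<close> over all pairs is computed twice. Summing over
  \<open>x\<close> first, only the trivial character contributes and the result is |G|; summing over
  \<open>\<psi>\<close> first, only \<open>x \<in> H\<close> contributes, giving |H| times the size
  of the annihilator. Lagrange's theorem finishes.\<close>

lemma card_annihilator:
  assumes fin: "finite (carrier G)" and H: "subgroup H G"
  shows "card (annihilator G H) = card (rcosets H)"
proof -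
  let ?A = "annihilator G H" and ?one = "\<lambda>x\<in>carrier G. 1 :: complex"
  have finA: "finite ?A"
    using finite_characters[OF fin] by (auto simp: annihilator_def)
  have Hsub: "H \<subseteq> carrier G" using H by (rule subgroup.subset)
  have one: "?one \<in> ?A"
    using Hsub by (auto simp: annihilator_def intro!: charactersI)
  have rows: "(\<Sum>x\<in>carrier G. \<psi> x) = (if \<psi> = ?one then of_nat (Coset.order G) else 0)" if "\<psi> \<in> ?A" for \<psi>
  proof (cases "\<psi> = ?one")
    case False
    have \<psi>: "\<psi> \<in> characters G" using that by (simp add: annihilator_def)
    obtain a where "a \<in> carrier G" "\<psi> a \<noteq> 1"
      using False extensionalityI[OF charactersD(3)[OF \<psi>] restrict_extensional, of "\<lambda>_. 1"] by auto
    then show ?thesis using sum_character[OF \<psi>] False by simp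
  qed (simp add: Coset.order_def)
  have cols: "(\<Sum>\<psi>\<in>?A. \<psi> x) = (if x \<in> H then of_nat (card ?A) else 0)" if "x \<in> carrier G" for x
    using sum_annihilator[OF fin H that] by (auto simp: annihilator_def)
  have "of_nat (Coset.order G) = (\<Sum>\<psi>\<in>?A. \<Sum>x\<in>carrier G. \<psi> x)"
    using one finA by (simp add: rows)
  also have "\<dots> = (\<Sum>x\<in>carrier G. \<Sum>\<psi>\<in>?A. \<psi> x)" by (rule sum.swap)
  also have "\<dots> = of_nat (card H * card ?A)"
    using fin Hsub by (simp add: cols sum.If_cases Int_absorb1)
  finally have "Coset.order G = card H * card ?A" by (metis of_nat_eq_iff)
  moreover have "card (rcosets H) * card H = Coset.order G" using lagrange[OF H] .
  moreover have "card H \<noteq> 0"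
    using finite_subset[OF Hsub fin] subgroup.one_closed[OF H] by auto
  ultimately show ?thesis by (metis mult.commute mult_left_cancel)
qed

text \<open>A member of the annihilator is constant on cosets, so its sum over \<open>G\<close>,
  which is 0, equals |H| times its sum over representatives.\<close>

lemma sum_annihilator_representatives:
  assumes fin: "finite (carrier G)" and H: "subgroup H G"
    and k: "bij_betw k I (rcosets H)" and g: "\<And>i. i \<in> I \<Longrightarrow> g i \<in> k i"
    and \<psi>: "\<psi> \<in> annihilator G H" and a: "a \<in> carrier G" "\<psi> a \<noteq> 1"
  shows "(\<Sum>i\<in>I. \<psi> (g i)) = 0"
proof -
  have ch: "\<psi> \<in> characters G" and triv: "\<And>h. h \<in> H \<Longrightarrow> \<psi> h = 1"
    using \<psi> by (auto simp: annihilator_def)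
  have kc: "k i \<in> rcosets H" if "i \<in> I" for i
    using k that by (auto simp: bij_betw_def)
  have sub: "k i \<subseteq> carrier G" if "i \<in> I" for i
    using kc[OF that] rcosets_part_G[OF H] by blast
  have finI: "finite I"
    using bij_betw_finite[OF k] cosets_finite fin rcosets_part_G[OF H]
    by (metis finite_UnionD)
  have const: "\<psi> x = \<psi> (g i)" if i: "i \<in> I" and x: "x \<in> k i" for x i
  proof -
    have gi: "g i \<in> carrier G" using sub[OF i] g[OF i] by blast
    obtain y where y: "y \<in> carrier G" "k i = H #> y"
      using kc[OF i] by (auto simp: RCOSETS_def)
    have "k i = H #> g i"
      using repr_independence[of "g i" H y] g[OF i] y H by simp
    then obtain h where h: "h \<in> H" "x = h \<otimes> g i"
      using x by (auto simp: r_coset_def)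
    then show ?thesis
      using charactersD(2)[OF ch _ gi, of h] triv subgroup.mem_carrier[OF H] by simp
  qed
  have "carrier G = (\<Union>i\<in>I. k i)"
    using rcosets_part_G[OF H] k by (simp add: bij_betw_def)
  then have "(\<Sum>x\<in>carrier G. \<psi> x) = (\<Sum>x\<in>(\<Union>i\<in>I. k i). \<psi> x)" by simp
  also have "\<dots> = (\<Sum>i\<in>I. \<Sum>x\<in>k i. \<psi> x)"
  proof (rule sum.UNION_disjoint[OF finI])
    show "\<forall>i\<in>I. finite (k i)" using sub fin finite_subset by blast
    show "\<forall>i\<in>I. \<forall>j\<in>I. i \<noteq> j \<longrightarrow> k i \<inter> k j = {}"
      using rcos_disjoint[OF H] k kc unfolding bij_betw_def inj_on_def pairwise_def disjnt_def by metis
  qed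
  also have "\<dots> = (\<Sum>i\<in>I. of_nat (card H) * \<psi> (g i))"
  proof (rule sum.cong[OF refl])
    fix i assume i: "i \<in> I"
    have "card (k i) = card H"
      using card_cosets_equal[OF kc[OF i] subgroup.subset[OF H]] bij_betw_same_card by metis
    then show "(\<Sum>x\<in>k i. \<psi> x) = of_nat (card H) * \<psi> (g i)" using const[OF i] by simp
  qed
  finally have "of_nat (card H) * (\<Sum>i\<in>I. \<psi> (g i)) = 0"
    using sum_character[OF ch a] by (simp add: sum_distrib_left)
  moreover have "card H \<noteq> 0"
    using finite_subset[OF subgroup.subset[OF H] fin] subgroup.one_closed[OF H] by auto
  ultimately show ?thesis by simp
qed

end

section \<open>Singular values, operator norm and determinant\<close>

lemma mat_adjoint_dim [simp]:
  "dim_row (mat_adjoint A) = dim_col A" "dim_col (mat_adjoint A) = dim_row A"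
  by (simp_all add: mat_adjoint_def)

lemma mat_adjoint_carrier [simp]: "A \<in> carrier_mat n k \<Longrightarrow> mat_adjoint A \<in> carrier_mat k n"
  by auto

lemma mat_adjoint_index:
  fixes A :: "complex mat"
  assumes "i < dim_col A" "j < dim_row A"
  shows "mat_adjoint A $$ (i, j) = cnj (A $$ (j, i))"
  using assms by (simp add: mat_adjoint_def mat_of_rows_index)

lemma mat_adjoint_mult:
  fixes A B :: "complex mat"
  assumes "A \<in> carrier_mat n k" "B \<in> carrier_mat k p"
  shows "mat_adjoint (A * B) = mat_adjoint B * mat_adjoint A"
  using assms
  by (intro eq_matI) (auto simp: mat_adjoint_index scalar_prod_def mult.commute intro!: sum.cong)

lemma vec_norm2_square: "(vec_norm2 v)\<^sup>2 = (\<Sum>i<dim_vec v. (cmod (v $ i))\<^sup>2)"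
  by (simp add: vec_norm2_def L2_set_def sum_nonneg)

lemma vec_norm2_nonneg [simp]: "0 \<le> vec_norm2 v"
  by (simp add: vec_norm2_def)

lemma vec_norm2_eq_0_iff: "v \<in> carrier_vec n \<Longrightarrow> vec_norm2 v = 0 \<longleftrightarrow> v = 0\<^sub>v n"
  by (auto simp: vec_norm2_def L2_set_eq_0_iff intro!: eq_vecI)

lemma vec_norm2_smult: "vec_norm2 (c \<cdot>\<^sub>v v) = cmod c * vec_norm2 v"
  unfolding vec_norm2_def
  by (subst L2_set_right_distrib) (auto simp: norm_mult intro!: L2_set_cong)

lemma vec_norm2_unit_vec:
  assumes "i < n"
  shows "vec_norm2 (unit_vec n i) = 1"
proof -
  have "(vec_norm2 (unit_vec n i))\<^sup>2 = (\<Sum>j<n. if j = i then 1 else 0)"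
    unfolding vec_norm2_square using assms by (intro sum.cong) auto
  then have "(vec_norm2 (unit_vec n i))\<^sup>2 = 1\<^sup>2" using assms by simp
  then show ?thesis by (simp only: power2_eq_iff_nonneg[OF vec_norm2_nonneg zero_le_one])
qed

lemma vec_norm2_append: "(vec_norm2 (v @\<^sub>v w))\<^sup>2 = (vec_norm2 v)\<^sup>2 + (vec_norm2 w)\<^sup>2"
proof -
  have split: "(\<Sum>i<a + b. f i) = (\<Sum>i<a. f i) + (\<Sum>i<b. f (a + i))"
    for a b and f :: "nat \<Rightarrow> real"
    by (induction b) auto
  show ?thesis by (simp add: vec_norm2_square split)
qed

lemma of_real_vec_norm2_square:
  "complex_of_real ((vec_norm2 v)\<^sup>2) = (\<Sum>i<dim_vec v. v $ i * cnj (v $ i))"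
  by (simp add: vec_norm2_square complex_norm_square del: of_real_power)

text \<open>The adjoint relation in coordinates. It links Gram matrices with lengths: a scalar Gram
  matrix gives a scaled isometry, and an eigenvector of a Gram matrix shows its eigenvalue to be a
  quotient of squared lengths.\<close>

lemma of_real_vec_norm2_mult_mat_vec:
  assumes A: "A \<in> carrier_mat n k" and v: "v \<in> carrier_vec k"
  shows "complex_of_real ((vec_norm2 (A *\<^sub>v v))\<^sup>2)
    = (\<Sum>j<k. ((mat_adjoint A * A) *\<^sub>v v) $ j * cnj (v $ j))"
proof -
  have dims: "dim_row A = n" "dim_col A = k" "dim_vec v = k" using assms by auto
  have "complex_of_real ((vec_norm2 (A *\<^sub>v v))\<^sup>2)
    = (\<Sum>i<n. (A *\<^sub>v v) $ i * cnj (\<Sum>j<k. A $$ (i, j) * v $ j))"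
    unfolding of_real_vec_norm2_square using dims
    by (auto simp: scalar_prod_def lessThan_atLeast0 intro!: sum.cong)
  also have "\<dots> = (\<Sum>i<n. \<Sum>j<k. (A *\<^sub>v v) $ i * (cnj (A $$ (i, j)) * cnj (v $ j)))"
    by (simp add: sum_distrib_left)
  also have "\<dots> = (\<Sum>j<k. \<Sum>i<n. (A *\<^sub>v v) $ i * (cnj (A $$ (i, j)) * cnj (v $ j)))"
    by (rule sum.swap)
  also have "\<dots> = (\<Sum>j<k. (mat_adjoint A *\<^sub>v (A *\<^sub>v v)) $ j * cnj (v $ j))"
    using dims
    by (auto simp: scalar_prod_def[of "row (mat_adjoint A) _"] mat_adjoint_index lessThan_atLeast0
        sum_distrib_left mult_ac intro!: sum.cong)
  also have "mat_adjoint A *\<^sub>v (A *\<^sub>v v) = (mat_adjoint A * A) *\<^sub>v v"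
    using A v by (intro assoc_mult_mat_vec[symmetric]) auto
  finally show ?thesis .
qed

lemma vec_norm2_scaled_unitary:
  assumes U: "U \<in> carrier_mat n n" and c: "0 \<le> c"
    and UU: "mat_adjoint U * U = complex_of_real c \<cdot>\<^sub>m 1\<^sub>m n" and v: "v \<in> carrier_vec n"
  shows "vec_norm2 (U *\<^sub>v v) = sqrt c * vec_norm2 v"
proof -
  have "complex_of_real ((vec_norm2 (U *\<^sub>v v))\<^sup>2) = (\<Sum>j<n. complex_of_real c * (v $ j * cnj (v $ j)))"
  proof -
    have "(complex_of_real c \<cdot>\<^sub>m 1\<^sub>m n) *\<^sub>v v = complex_of_real c \<cdot>\<^sub>v v"
      using v by (auto intro!: eq_vecI)
    then show ?thesis
      unfolding of_real_vec_norm2_mult_mat_vec[OF U v] UU using v by (auto intro!: sum.cong)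
  qed
  also have "\<dots> = complex_of_real (c * (vec_norm2 v)\<^sup>2)"
    using v of_real_vec_norm2_square[of v] by (simp add: sum_distrib_left[symmetric])
  finally have "(vec_norm2 (U *\<^sub>v v))\<^sup>2 = (sqrt c * vec_norm2 v)\<^sup>2"
    using c by (simp only: of_real_eq_iff power_mult_distrib real_sqrt_pow2)
  then show ?thesis using c by (simp add: power2_eq_iff_nonneg)
qed

text \<open>For square matrices a left inverse is a right inverse. The pair of identities yields a
  similarity, and the second one alone yields surjectivity of \<open>U\<close>.\<close>

lemma scaled_unitary_inverse:
  assumes U: "U \<in> carrier_mat n n" and c: "0 < c"
    and UU: "mat_adjoint U * U = complex_of_real c \<cdot>\<^sub>m 1\<^sub>m n"
  shows "(complex_of_real (1 / c) \<cdot>\<^sub>m mat_adjoint U) * U = 1\<^sub>m n"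
    and "U * (complex_of_real (1 / c) \<cdot>\<^sub>m mat_adjoint U) = 1\<^sub>m n"
proof -
  have "(complex_of_real (1 / c) \<cdot>\<^sub>m mat_adjoint U) * U = complex_of_real (1 / c) \<cdot>\<^sub>m (mat_adjoint U * U)"
    using U by (intro mult_smult_assoc_mat) auto
  also have "\<dots> = 1\<^sub>m n" unfolding UU using c by (intro eq_matI) auto
  finally show 1: "(complex_of_real (1 / c) \<cdot>\<^sub>m mat_adjoint U) * U = 1\<^sub>m n" .
  show "U * (complex_of_real (1 / c) \<cdot>\<^sub>m mat_adjoint U) = 1\<^sub>m n"
    by (rule mat_mult_left_right_inverse[OF _ U 1]) (use U in auto)
qed

text \<open>Taking determinants in the hypothesis gives |det U|^2 = c^n, because conjugation, being
  a ring homomorphism, commutes with \<open>det\<close>.\<close>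

lemma cmod_det_scaled_unitary:
  assumes U: "U \<in> carrier_mat n n" and c: "0 \<le> c"
    and UU: "mat_adjoint U * U = complex_of_real c \<cdot>\<^sub>m 1\<^sub>m n"
  shows "cmod (det U) = sqrt c ^ n"
proof -
  have "mat_adjoint U = transpose_mat (map_mat cnj U)"
    by (intro eq_matI) (auto simp: mat_adjoint_index)
  then have "det (mat_adjoint U) = det (map_mat cnj U)"
    using U by (simp add: det_transpose[of _ n])
  also have "\<dots> = cnj (det U)"
  proof -
    interpret cnj: comm_ring_hom cnj by unfold_locales auto
    show ?thesis by (rule cnj.hom_det)
  qed
  finally have "cnj (det U) * det U = complex_of_real c ^ n"
    using arg_cong[OF UU, of det] U by (simp add: det_mult[of _ n] det_smult)
  then have "complex_of_real ((cmod (det U))\<^sup>2) = complex_of_real (c ^ n)"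
    unfolding complex_norm_square by (simp add: mult.commute)
  then have "(cmod (det U))\<^sup>2 = (sqrt c ^ n)\<^sup>2"
    using c by (simp only: of_real_eq_iff power_mult[symmetric] mult.commute[of n])
       (simp only: power_mult real_sqrt_pow2)
  then show ?thesis using c by (simp add: power2_eq_iff_nonneg)
qed

section \<open>Singular values under multiplication by unitary matrices\<close>

lemma finite_singular_values:
  assumes A: "A \<in> carrier_mat n n"
  shows "finite (singular_values A)"
proof (rule finite_imageD)
  have M: "mat_adjoint A * A \<in> carrier_mat n n" using A by auto
  show "finite ((\<lambda>s. complex_of_real (s\<^sup>2)) ` singular_values A)"
    by (rule finite_subset[OF _ card_finite_spectrum(1)[OF M]])
       (auto simp: singular_values_def spectrum_def)
  show "inj_on (\<lambda>s. complex_of_real (s\<^sup>2)) (singular_values A)"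
    by (auto simp: inj_on_def singular_values_def power2_eq_iff_nonneg simp del: of_real_power)
qed

text \<open>Over the complex numbers the Gram matrix has an eigenvalue, and an eigenvector
  \<open>v\<close> exhibits it as the square of |Av| / |v|. With finiteness, this makes the
  \<open>Min\<close> in \<open>sigma_min\<close> an actual minimum.\<close>

lemma singular_values_nonempty:
  assumes A: "A \<in> carrier_mat n n" and n: "0 < n"
  shows "singular_values A \<noteq> {}"
proof -
  have M: "mat_adjoint A * A \<in> carrier_mat n n" using A by auto
  obtain e where "eigenvalue (mat_adjoint A * A) e"
    using spectrum_non_empty[OF M n] by (auto simp: spectrum_def)
  then obtain v where v: "v \<in> carrier_vec n" "v \<noteq> 0\<^sub>v n" "(mat_adjoint A * A) *\<^sub>v v = e \<cdot>\<^sub>v v"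
    using A by (auto simp: eigenvalue_def eigenvector_def)
  have "complex_of_real ((vec_norm2 (A *\<^sub>v v))\<^sup>2) = e * complex_of_real ((vec_norm2 v)\<^sup>2)"
    unfolding of_real_vec_norm2_mult_mat_vec[OF A v(1)] of_real_vec_norm2_square[of v] v(3)
    using v(1) by (auto simp: sum_distrib_left mult.assoc intro!: sum.cong)
  moreover have "vec_norm2 v \<noteq> 0" using vec_norm2_eq_0_iff[OF v(1)] v(2) by blast
  ultimately have "e = complex_of_real ((vec_norm2 (A *\<^sub>v v) / vec_norm2 v)\<^sup>2)"
    by (simp add: power_divide field_simps)
  then have "vec_norm2 (A *\<^sub>v v) / vec_norm2 v \<in> singular_values A"
    using \<open>eigenvalue (mat_adjoint A * A) e\<close> by (simp add: singular_values_def)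
  then show ?thesis by blast
qed

lemma eigenvalue_smult_iff:
  fixes M :: "complex mat"
  assumes M: "M \<in> carrier_mat n n" and c: "c \<noteq> 0"
  shows "eigenvalue (c \<cdot>\<^sub>m M) e \<longleftrightarrow> eigenvalue M (e / c)"
proof -
  have "(c \<cdot>\<^sub>m M) *\<^sub>v v = e \<cdot>\<^sub>v v \<longleftrightarrow> M *\<^sub>v v = (e / c) \<cdot>\<^sub>v v" if v: "v \<in> carrier_vec n" for v
  proof -
    have "(c \<cdot>\<^sub>m M) *\<^sub>v v = c \<cdot>\<^sub>v (M *\<^sub>v v)" using M v by auto
    moreover have "c \<cdot>\<^sub>v (M *\<^sub>v v) = e \<cdot>\<^sub>v v \<longleftrightarrow> M *\<^sub>v v = (e / c) \<cdot>\<^sub>v v"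
      using M v c by (auto simp: vec_eq_iff field_simps)
    ultimately show ?thesis by simp
  qed
  then show ?thesis using M by (auto simp: eigenvalue_def eigenvector_def)
qed

lemma singular_values_scale:
  assumes c: "0 < c"
    and eig: "\<And>e. eigenvalue (mat_adjoint B * B) e \<longleftrightarrow> eigenvalue (mat_adjoint A * A) (e / complex_of_real c)"
  shows "singular_values B = (\<lambda>s. sqrt c * s) ` singular_values A"
proof (intro equalityI subsetI)
  fix s assume s: "s \<in> singular_values B"
  have "(s / sqrt c)\<^sup>2 = s\<^sup>2 / c" using c by (simp add: power_divide)
  then have "complex_of_real ((s / sqrt c)\<^sup>2) = complex_of_real (s\<^sup>2) / complex_of_real c"
    by (simp only: of_real_divide)
  then have "s / sqrt c \<in> singular_values A"
    using s eig[of "complex_of_real (s\<^sup>2)"] c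
    by (simp add: singular_values_def del: of_real_power of_real_divide)
  then show "s \<in> (\<lambda>s. sqrt c * s) ` singular_values A"
    using c by (intro image_eqI[of _ _ "s / sqrt c"]) auto
next
  fix s assume "s \<in> (\<lambda>s. sqrt c * s) ` singular_values A"
  then obtain t where t: "s = sqrt c * t" "t \<in> singular_values A" by blast
  have "s\<^sup>2 / c = t\<^sup>2" using c t by (simp add: power_mult_distrib)
  then have "complex_of_real (s\<^sup>2) / complex_of_real c = complex_of_real (t\<^sup>2)"
    by (simp only: of_real_divide[symmetric])
  then show "s \<in> singular_values B"
    using t eig[of "complex_of_real (s\<^sup>2)"] c
    by (simp add: singular_values_def del: of_real_power of_real_divide)
qed

text \<open>The Gram matrix itself does not change.\<close>

lemma singular_values_left_unitary:
  assumes U: "U \<in> carrier_mat n n" and A: "A \<in> carrier_mat n n"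
    and UU: "mat_adjoint U * U = 1\<^sub>m n"
  shows "singular_values (U * A) = singular_values A"
proof -
  have "mat_adjoint (U * A) * (U * A) = mat_adjoint A * (mat_adjoint U * (U * A))"
    unfolding mat_adjoint_mult[OF U A] using U A by (intro assoc_mult_mat[of _ n n _ n _ n]) auto
  also have "mat_adjoint U * (U * A) = (mat_adjoint U * U) * A"
    using U A by (intro assoc_mult_mat[symmetric, of _ n n _ n _ n]) auto
  also have "\<dots> = A" unfolding UU using A by simp
  finally show ?thesis by (simp add: singular_values_def)
qed

text \<open>The Gram matrix of \<open>A * V\<close> is similar to \<open>c\<close> times that of
  \<open>A\<close>, so both have the same characteristic polynomial and hence the same
  eigenvalues.\<close>

lemma singular_values_right_scaled_unitary:
  assumes A: "A \<in> carrier_mat n n" and V: "V \<in> carrier_mat n n" and c: "0 < c"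
    and VV: "mat_adjoint V * V = complex_of_real c \<cdot>\<^sub>m 1\<^sub>m n"
  shows "singular_values (A * V) = (\<lambda>s. sqrt c * s) ` singular_values A"
proof (rule singular_values_scale[OF c])
  fix e
  let ?W = "complex_of_real (1 / c) \<cdot>\<^sub>m mat_adjoint V" and ?M = "mat_adjoint A * A"
  have M: "?M \<in> carrier_mat n n" and W: "?W \<in> carrier_mat n n"
    and N: "mat_adjoint (A * V) * (A * V) \<in> carrier_mat n n" using A V by auto
  have cM: "complex_of_real c \<cdot>\<^sub>m ?M \<in> carrier_mat n n" using M by (rule smult_carrier_mat)
  \<comment> \<open>Moving \<open>c\<close> from the adjoint to the Gram matrix leaves
    \<open>?W\<close>, the exact inverse of \<open>V\<close>.\<close>
  have adj: "mat_adjoint V = complex_of_real c \<cdot>\<^sub>m ?W"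
    using c V by (intro eq_matI) auto
  have conj: "mat_adjoint (A * V) * (A * V) = mat_adjoint V * ?M * V"
  proof -
    have "mat_adjoint V * mat_adjoint A * (A * V) = mat_adjoint V * mat_adjoint A * A * V"
      using A V by (intro assoc_mult_mat[symmetric, of _ n n _ n _ n]) auto
    also have "mat_adjoint V * mat_adjoint A * A = mat_adjoint V * ?M"
      using A V by (intro assoc_mult_mat[of _ n n _ n _ n]) auto
    finally show ?thesis unfolding mat_adjoint_mult[OF A V] .
  qed
  have "mat_adjoint V * ?M = ?W * (complex_of_real c \<cdot>\<^sub>m ?M)"
  proof -
    have "mat_adjoint V * ?M = (complex_of_real c \<cdot>\<^sub>m ?W) * ?M" using adj by (rule arg_cong)
    also have "\<dots> = complex_of_real c \<cdot>\<^sub>m (?W * ?M)" using W M by (rule mult_smult_assoc_mat)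
    also have "\<dots> = ?W * (complex_of_real c \<cdot>\<^sub>m ?M)" using W M by (rule mult_smult_distrib[symmetric])
    finally show ?thesis .
  qed
  from conj[unfolded this]
  have eq: "mat_adjoint (A * V) * (A * V) = ?W * (complex_of_real c \<cdot>\<^sub>m ?M) * V" .
  have "similar_mat_wit (mat_adjoint (A * V) * (A * V)) (complex_of_real c \<cdot>\<^sub>m ?M) ?W V"
    by (rule similar_mat_witI[OF scaled_unitary_inverse[OF V c VV] eq N cM W V])
  then have "char_poly (mat_adjoint (A * V) * (A * V)) = char_poly (complex_of_real c \<cdot>\<^sub>m ?M)"
    by (intro char_poly_similar) (auto simp: similar_mat_def)
  then have "eigenvalue (mat_adjoint (A * V) * (A * V)) e \<longleftrightarrow> eigenvalue (complex_of_real c \<cdot>\<^sub>m ?M) e"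
    unfolding eigenvalue_root_char_poly[OF cM] eigenvalue_root_char_poly[OF N] by simp
  also have "\<dots> \<longleftrightarrow> eigenvalue ?M (e / complex_of_real c)"
    using eigenvalue_smult_iff[OF M, of "complex_of_real c"] c by simp
  finally show "eigenvalue (mat_adjoint (A * V) * (A * V)) e \<longleftrightarrow> eigenvalue ?M (e / complex_of_real c)" .
qed

section \<open>The operator norm through its upper bounds\<close>

lemma vec_norm2_mult_mat_vec_bounded:
  assumes A: "A \<in> carrier_mat n k" and v: "v \<in> carrier_vec k"
  shows "vec_norm2 (A *\<^sub>v v) \<le> (\<Sum>i<n. \<Sum>j<k. cmod (A $$ (i, j))) * vec_norm2 v"
proof -
  have entry: "cmod (v $ j) \<le> vec_norm2 v" if "j < k" for j
    using that v unfolding vec_norm2_def by (intro member_le_L2_set) auto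
  have "vec_norm2 (A *\<^sub>v v) \<le> (\<Sum>i<n. cmod ((A *\<^sub>v v) $ i))"
    using A unfolding vec_norm2_def by (auto simp del: index_mult_mat_vec intro!: L2_set_le_sum)
  also have "\<dots> \<le> (\<Sum>i<n. \<Sum>j<k. cmod (A $$ (i, j)) * vec_norm2 v)"
  proof (rule sum_mono)
    fix i assume i: "i \<in> {..<n}"
    have "(A *\<^sub>v v) $ i = (\<Sum>j<k. A $$ (i, j) * v $ j)"
      using A v i by (auto simp: scalar_prod_def lessThan_atLeast0 intro!: sum.cong)
    also have "cmod \<dots> \<le> (\<Sum>j<k. cmod (A $$ (i, j)) * vec_norm2 v)"
      by (intro order_trans[OF norm_sum] sum_mono)
         (auto simp: norm_mult entry intro!: mult_left_mono)
    finally show "cmod ((A *\<^sub>v v) $ i) \<le> (\<Sum>j<k. cmod (A $$ (i, j)) * vec_norm2 v)" .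
  qed
  finally show ?thesis by (simp add: sum_distrib_right)
qed

text \<open>Homogeneity trades the unit sphere for all vectors. Norms are compared below by showing
  that they have the same upper bounds, so the supremum itself does not reappear. With
  \<open>0 < k\<close> there is a unit vector, so the set under the supremum is nonempty.\<close>

lemma op_norm2_le_iff:
  assumes A: "A \<in> carrier_mat n k" and k: "0 < k"
  shows "op_norm2 A \<le> c \<longleftrightarrow> (\<forall>v\<in>carrier_vec k. vec_norm2 (A *\<^sub>v v) \<le> c * vec_norm2 v)"
proof -
  let ?S = "{vec_norm2 (A *\<^sub>v v) | v. v \<in> carrier_vec (dim_col A) \<and> vec_norm2 v = 1}"
  have "vec_norm2 (unit_vec k 0) = 1"
    using k by (rule vec_norm2_unit_vec)
  then have "?S \<noteq> {}" using A unit_vec_carrier[of k 0] by blast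
  moreover have "bdd_above ?S"
    \<comment> \<open>The sum of the moduli of the entries is a crude bound that serves only to make
      the supremum meaningful.\<close>
    by (rule bdd_aboveI[of _ "\<Sum>i<n. \<Sum>j<k. cmod (A $$ (i, j))"])
       (use A vec_norm2_mult_mat_vec_bounded[OF A] in force)
  ultimately have "op_norm2 A \<le> c \<longleftrightarrow> (\<forall>s\<in>?S. s \<le> c)"
    unfolding op_norm2_def by (rule cSup_le_iff)
  also have "\<dots> \<longleftrightarrow> (\<forall>v\<in>carrier_vec k. vec_norm2 (A *\<^sub>v v) \<le> c * vec_norm2 v)"
  proof (intro iffI ballI)
    fix v :: "complex vec" assume bound: "\<forall>s\<in>?S. s \<le> c" and v: "v \<in> carrier_vec k"
    show "vec_norm2 (A *\<^sub>v v) \<le> c * vec_norm2 v"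
    proof (cases "vec_norm2 v = 0")
      case True
      then show ?thesis using vec_norm2_mult_mat_vec_bounded[OF A v] by simp
    next
      case False
      then have pos: "0 < vec_norm2 v" by (simp add: order_less_le)
      let ?a = "complex_of_real (1 / vec_norm2 v)"
      have "vec_norm2 (?a \<cdot>\<^sub>v v) = 1" using pos by (simp add: vec_norm2_smult norm_divide)
      moreover have "?a \<cdot>\<^sub>v v \<in> carrier_vec (dim_col A)" using v A by auto
      ultimately have "vec_norm2 (A *\<^sub>v (?a \<cdot>\<^sub>v v)) \<le> c" using bound by blast
      moreover have "A *\<^sub>v (?a \<cdot>\<^sub>v v) = ?a \<cdot>\<^sub>v (A *\<^sub>v v)" using A v by (rule mult_mat_vec)
      ultimately show ?thesis using pos by (simp add: vec_norm2_smult norm_divide field_simps)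
    qed
  next
    fix s assume "\<forall>v\<in>carrier_vec k. vec_norm2 (A *\<^sub>v v) \<le> c * vec_norm2 v" and "s \<in> ?S"
    then show "s \<le> c" using A by force
  qed
  finally show ?thesis .
qed

lemma op_norm2_nonneg:
  assumes A: "A \<in> carrier_mat n k" and k: "0 < k"
  shows "0 \<le> op_norm2 A"
proof -
  have "vec_norm2 (unit_vec k 0) = 1"
    using k by (rule vec_norm2_unit_vec)
  moreover have "vec_norm2 (A *\<^sub>v unit_vec k 0) \<le> op_norm2 A * vec_norm2 (unit_vec k 0)"
    using op_norm2_le_iff[OF assms, of "op_norm2 A"] by simp
  ultimately show ?thesis 
    by (metis order_trans vec_norm2_nonneg mult.right_neutral)
qed

lemma op_norm2_left_unitary:
  assumes U: "U \<in> carrier_mat n n" and A: "A \<in> carrier_mat n n" and n: "0 < n"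
    and UU: "mat_adjoint U * U = 1\<^sub>m n"
  shows "op_norm2 (U * A) = op_norm2 A"
proof -
  have "mat_adjoint U * U = complex_of_real 1 \<cdot>\<^sub>m 1\<^sub>m n" unfolding UU by (intro eq_matI) auto
  from vec_norm2_scaled_unitary[OF U _ this]
  have "vec_norm2 ((U * A) *\<^sub>v v) = vec_norm2 (A *\<^sub>v v)" if "v \<in> carrier_vec n" for v
    using A U that by (simp add: assoc_mult_mat_vec[of _ n n _ n])
  then have "op_norm2 (U * A) \<le> c \<longleftrightarrow> op_norm2 A \<le> c" for c
    using U A n by (simp add: op_norm2_le_iff[of _ n n])
  then show ?thesis by (metis order_antisym order_refl)
qed

text \<open>Substituting w = Vv turns a bound for \<open>A * V\<close> into one for
  \<open>A\<close>: \<open>V\<close> is onto and stretches every length by the same factor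
  \<open>sqrt c\<close>.\<close>

lemma op_norm2_right_scaled_unitary:
  assumes A: "A \<in> carrier_mat n n" and V: "V \<in> carrier_mat n n" and n: "0 < n" and c: "0 < c"
    and VV: "mat_adjoint V * V = complex_of_real c \<cdot>\<^sub>m 1\<^sub>m n"
  shows "op_norm2 (A * V) = sqrt c * op_norm2 A"
proof -
  let ?W = "complex_of_real (1 / c) \<cdot>\<^sub>m mat_adjoint V"
  have W: "?W \<in> carrier_mat n n" using V by auto
  note norm = vec_norm2_scaled_unitary[OF V less_imp_le[OF c] VV]
  have "op_norm2 (A * V) \<le> sqrt c * t \<longleftrightarrow> op_norm2 A \<le> t" for t
  proof -
    have "(\<forall>v\<in>carrier_vec n. vec_norm2 ((A * V) *\<^sub>v v) \<le> (sqrt c * t) * vec_norm2 v)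
      \<longleftrightarrow> (\<forall>v\<in>carrier_vec n. vec_norm2 (A *\<^sub>v (V *\<^sub>v v)) \<le> t * vec_norm2 (V *\<^sub>v v))"
      using A V by (simp add: norm assoc_mult_mat_vec[of _ n n _ n] mult_ac)
    also have "\<dots> \<longleftrightarrow> (\<forall>w\<in>carrier_vec n. vec_norm2 (A *\<^sub>v w) \<le> t * vec_norm2 w)"
    proof (intro iffI ballI)
      fix w :: "complex vec" assume *: "\<forall>v\<in>carrier_vec n. vec_norm2 (A *\<^sub>v (V *\<^sub>v v)) \<le> t * vec_norm2 (V *\<^sub>v v)"
        and w: "w \<in> carrier_vec n"
      have "V *\<^sub>v (?W *\<^sub>v w) = (V * ?W) *\<^sub>v w"
        using V W w by (intro assoc_mult_mat_vec[symmetric]) auto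
      also have "\<dots> = w" unfolding scaled_unitary_inverse(2)[OF V c VV] using w by simp
      finally show "vec_norm2 (A *\<^sub>v w) \<le> t * vec_norm2 w"
        using *[rule_format, of "?W *\<^sub>v w"] W w by simp
    qed (use V in auto)
    finally show ?thesis using A V n by (simp add: op_norm2_le_iff[of _ n n])
  qed
  \<comment> \<open>Each instance makes one side of the equivalence an equality; together they give
    both inequalities.\<close>
  from this[of "op_norm2 A"] this[of "op_norm2 (A * V) / sqrt c"] show ?thesis
    using c by (auto simp: field_simps intro: order_antisym)
qed

section \<open>Block diagonal matrices\<close>

lemma mat_adjoint_four_block:
  fixes A D :: "complex mat"
  assumes "A \<in> carrier_mat n n" "D \<in> carrier_mat k k"
  shows "mat_adjoint (four_block_mat A (0\<^sub>m n k) (0\<^sub>m k n) D)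
    = four_block_mat (mat_adjoint A) (0\<^sub>m n k) (0\<^sub>m k n) (mat_adjoint D)"
  using assms by (intro eq_matI) (auto simp: mat_adjoint_index)

text \<open>The Gram matrix is again block diagonal, so its characteristic polynomial is the product
  of those of the blocks.\<close>

lemma singular_values_four_block:
  assumes A: "A \<in> carrier_mat n n" and D: "D \<in> carrier_mat k k"
  shows "singular_values (four_block_mat A (0\<^sub>m n k) (0\<^sub>m k n) D) = singular_values A \<union> singular_values D"
proof -
  let ?F = "four_block_mat A (0\<^sub>m n k) (0\<^sub>m k n) D"
  let ?MA = "mat_adjoint A * A" and ?MD = "mat_adjoint D * D"
  have M: "?MA \<in> carrier_mat n n" "?MD \<in> carrier_mat k k" using A D by auto
  have eq: "mat_adjoint ?F * ?F = four_block_mat ?MA (0\<^sub>m n k) (0\<^sub>m k n) ?MD"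
    unfolding mat_adjoint_four_block[OF A D]
    by (subst mult_four_block_mat[of _ n n _ k _ k _ _ n _ k])
       (use A D M in \<open>auto simp: left_add_zero_mat right_add_zero_mat\<close>)
  have "char_poly (mat_adjoint ?F * ?F) = char_poly ?MA * char_poly ?MD"
    using char_poly_factorized[OF M(1)] char_poly_factorized[OF M(2)]
    by (intro char_poly_0_block[OF eq _ _ M(1) _ M(2)]) auto
  moreover have "mat_adjoint ?F * ?F \<in> carrier_mat (n + k) (n + k)"
    using A D by auto
  ultimately have "eigenvalue (mat_adjoint ?F * ?F) e \<longleftrightarrow> eigenvalue ?MA e \<or> eigenvalue ?MD e" for e
    using M by (simp add: eigenvalue_root_char_poly[of _ "n + k"] eigenvalue_root_char_poly[of _ n]
        eigenvalue_root_char_poly[of _ k])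
  then show ?thesis by (auto simp: singular_values_def)
qed

lemma diag_block_mat_carrier:
  assumes "\<forall>A\<in>set As. A \<in> carrier_mat l l"
  shows "diag_block_mat As \<in> carrier_mat (length As * l) (length As * l)"
proof -
  have "sum_list (map dim_row As) = length As * l" "sum_list (map dim_col As) = length As * l"
    using assms by (induction As) auto
  then show ?thesis by (auto simp: dim_diag_block_mat)
qed

lemma diag_block_mat_Cons_carrier:
  assumes "\<forall>B\<in>set (A # As). B \<in> carrier_mat l l"
  shows "diag_block_mat (A # As) = four_block_mat A (0\<^sub>m l (length As * l)) (0\<^sub>m (length As * l) l) (diag_block_mat As)"
proof -
  have "dim_row A = l" "dim_col A = l" "dim_row (diag_block_mat As) = length As * l"
    "dim_col (diag_block_mat As) = length As * l"
    using assms diag_block_mat_carrier[of As l] by auto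
  then show ?thesis by (simp add: Let_def)
qed

lemma singular_values_diag_block:
  assumes "\<forall>A\<in>set As. A \<in> carrier_mat l l"
  shows "singular_values (diag_block_mat As) = (\<Union>A\<in>set As. singular_values A)"
  using assms
proof (induction As)
  case Nil
  \<comment> \<open>The empty matrix has no nonzero vector, hence no eigenvalue, in accordance with
    the empty union.\<close>
  have "v = 0\<^sub>v 0" if "v \<in> carrier_vec 0" for v :: "complex vec" using that by auto
  then show ?case by (auto simp: singular_values_def eigenvalue_def eigenvector_def)
next
  case (Cons A As)
  then show ?case
    unfolding diag_block_mat_Cons_carrier[OF Cons.prems]
    using singular_values_four_block[of A l "diag_block_mat As" "length As * l"]
      diag_block_mat_carrier[of As l] by simp
qed

lemma det_diag_block:
  fixes As :: "'a :: idom mat list"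
  assumes "\<forall>A\<in>set As. A \<in> carrier_mat l l"
  shows "det (diag_block_mat As) = (\<Prod>A\<leftarrow>As. det A)"
  using assms
proof (induction As)
  case (Cons A As)
  then show ?case
    unfolding diag_block_mat_Cons_carrier[OF Cons.prems]
    using det_four_block_mat_lower_left_zero[of A l _ "length As * l" _ "diag_block_mat As"]
      diag_block_mat_carrier[of As l] by simp
qed simp

text \<open>By Pythagoras both sides of the squared inequality split along the blocks. The sign of
  \<open>c\<close> permits the passage to squares.\<close>

lemma diag_block_mat_bound_iff:
  assumes "\<forall>A\<in>set As. A \<in> carrier_mat l l" and c: "0 \<le> c"
  shows "(\<forall>v\<in>carrier_vec (length As * l). vec_norm2 (diag_block_mat As *\<^sub>v v) \<le> c * vec_norm2 v)
    \<longleftrightarrow> (\<forall>A\<in>set As. \<forall>v\<in>carrier_vec l. vec_norm2 (A *\<^sub>v v) \<le> c * vec_norm2 v)"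
  using assms(1)
proof (induction As)
  case Nil
  then show ?case by (auto simp: vec_norm2_def)
next
  case (Cons A As)
  let ?D = "diag_block_mat As" and ?k = "length As * l"
  have A: "A \<in> carrier_mat l l" and D: "?D \<in> carrier_mat ?k ?k"
    using Cons.prems diag_block_mat_carrier[of As l] by auto
  have sq: "vec_norm2 v \<le> c * vec_norm2 w \<longleftrightarrow> (vec_norm2 v)\<^sup>2 \<le> c\<^sup>2 * (vec_norm2 w)\<^sup>2" for v w
    using c by (metis mult_nonneg_nonneg vec_norm2_nonneg power_mult_distrib power2_le_iff_abs_le abs_of_nonneg)
  have zero: "vec_norm2 (M *\<^sub>v 0\<^sub>v k) = 0" "vec_norm2 (0\<^sub>v k) = 0"
    if "M \<in> carrier_mat k k" for M and k
    using that vec_norm2_eq_0_iff[of "M *\<^sub>v 0\<^sub>v k" k] vec_norm2_eq_0_iff[of "0\<^sub>v k" k] by auto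
  have split: "(vec_norm2 (diag_block_mat (A # As) *\<^sub>v (x @\<^sub>v y)))\<^sup>2 = (vec_norm2 (A *\<^sub>v x))\<^sup>2 + (vec_norm2 (?D *\<^sub>v y))\<^sup>2"
    if "x \<in> carrier_vec l" "y \<in> carrier_vec ?k" for x y
    unfolding diag_block_mat_Cons_carrier[OF Cons.prems] mult_mat_vec_split[OF A D that]
    by (rule vec_norm2_append)
  have "(\<forall>v\<in>carrier_vec (length (A # As) * l). vec_norm2 (diag_block_mat (A # As) *\<^sub>v v) \<le> c * vec_norm2 v)
    \<longleftrightarrow> (\<forall>x\<in>carrier_vec l. \<forall>y\<in>carrier_vec ?k.
        (vec_norm2 (A *\<^sub>v x))\<^sup>2 + (vec_norm2 (?D *\<^sub>v y))\<^sup>2 \<le> c\<^sup>2 * (vec_norm2 x)\<^sup>2 + c\<^sup>2 * (vec_norm2 y)\<^sup>2)"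
    using split by (simp add: all_vec_append sq vec_norm2_append distrib_left del: diag_block_mat.simps)
  also have "\<dots> \<longleftrightarrow> (\<forall>x\<in>carrier_vec l. vec_norm2 (A *\<^sub>v x) \<le> c * vec_norm2 x)
      \<and> (\<forall>y\<in>carrier_vec ?k. vec_norm2 (?D *\<^sub>v y) \<le> c * vec_norm2 y)" (is "?L \<longleftrightarrow> ?R")
  proof
    assume L: ?L
    \<comment> \<open>Each bound is isolated by taking the zero vector for the other
      component.\<close>
    show ?R
      unfolding sq using L[rule_format, OF _ zero_carrier_vec] L[rule_format, OF zero_carrier_vec]
        zero[OF A] zero[OF D] by simp
  next
    assume ?R
    then show ?L unfolding sq by (auto intro: add_mono)
  qed
  also have "\<dots> \<longleftrightarrow> (\<forall>B\<in>set (A # As). \<forall>v\<in>carrier_vec l. vec_norm2 (B *\<^sub>v v) \<le> c * vec_norm2 v)"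
    using Cons by simp
  finally show ?case .
qed

lemma op_norm2_diag_block:
  assumes As: "\<forall>A\<in>set As. A \<in> carrier_mat l l" and l: "0 < l" and ne: "As \<noteq> []"
  shows "op_norm2 (diag_block_mat As) = Max (op_norm2 ` set As)"
proof -
  have D: "diag_block_mat As \<in> carrier_mat (length As * l) (length As * l)" and pos: "0 < length As * l"
    using diag_block_mat_carrier[OF As] l ne by auto
  have le: "op_norm2 (diag_block_mat As) \<le> c \<longleftrightarrow> Max (op_norm2 ` set As) \<le> c" if "0 \<le> c" for c
    unfolding op_norm2_le_iff[OF D pos] diag_block_mat_bound_iff[OF As that]
    using As l ne by (auto simp: op_norm2_le_iff[of _ l l])
  \<comment> \<open>The comparison \<open>le\<close> is available only for nonnegative bounds, so
    both numbers must be known nonnegative before they are inserted as bounds.\<close>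
  have "0 \<le> op_norm2 (diag_block_mat As)" using op_norm2_nonneg[OF D pos] .
  moreover have "0 \<le> Max (op_norm2 ` set As)"
    using ne As op_norm2_nonneg[OF _ l]
    by (metis List.finite_set Max_ge_iff finite_imageI image_eqI image_is_empty list.set_sel(1) set_empty)
  ultimately show ?thesis using le by (metis order_antisym order_refl)
qed

text \<open>With blocks of equal size, an index is a block number \<open>a div l\<close> and an
  offset \<open>a mod l\<close>; this closed form replaces the recursion in the matrix product
  below.\<close>

lemma diag_block_mat_index:
  assumes "\<forall>A\<in>set As. A \<in> carrier_mat l l" "a < length As * l" "b < length As * l"
  shows "diag_block_mat As $$ (a, b)
    = (if a div l = b div l then (As ! (a div l)) $$ (a mod l, b mod l) else 0)"
  using assms
proof (induction As arbitrary: a b)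
  case (Cons A As)
  have l: "0 < l" using Cons.prems by (cases l) auto
  have A: "A \<in> carrier_mat l l" and D: "diag_block_mat As \<in> carrier_mat (length As * l) (length As * l)"
    using Cons.prems diag_block_mat_carrier[of As l] by auto
  \<comment> \<open>Dropping the first block lowers the block number by one and keeps the
    offset.\<close>
  have shift: "a div l = Suc ((a - l) div l)" "a mod l = (a - l) mod l" if "\<not> a < l" for a
    using that l by (simp_all add: le_div_geq le_mod_geq)
  show ?case
    unfolding diag_block_mat_Cons_carrier[OF Cons.prems(1)]
    using Cons.IH[of "a - l" "b - l"] Cons.prems A D
    by (auto simp: shift)
qed simp

section \<open>Multi-tilings\<close>

lemma sum_div_mod:
  fixes f :: "nat \<Rightarrow> nat \<Rightarrow> 'a :: comm_monoid_add"
  shows "(\<Sum>a<m * l. f (a div l) (a mod l)) = (\<Sum>i<m. \<Sum>r<l. f i r)"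
proof -
  have "(\<Sum>i<m. \<Sum>r<l. f i r) = (\<Sum>i<m. \<Sum>a\<in>{i * l..<i * l + l}. f (a div l) (a mod l))"
  proof (rule sum.cong[OF refl])
    fix i
    show "(\<Sum>r<l. f i r) = (\<Sum>a\<in>{i * l..<i * l + l}. f (a div l) (a mod l))"
      by (rule sum.reindex_bij_witness[where i = "\<lambda>a. a - i * l" and j = "\<lambda>r. i * l + r"])
         (auto simp: less_diff_conv2)
  qed
  also have "\<dots> = (\<Sum>a<m * l. f (a div l) (a mod l))" by (rule sum.nat_group)
  finally show ?thesis by simp
qed

text \<open>At \<open>b = 0\<close> the numerator is positive and both sides are infinite, so
  singular blocks are covered.\<close>

lemma ennreal_divide_cancel_real:
  assumes "0 < c" "0 \<le> a" "0 \<le> b" "0 < a \<or> 0 < b"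
  shows "ennreal (c * a) / ennreal (c * b) = ennreal a / ennreal b"
proof (cases "b = 0")
  case True
  then show ?thesis using assms by (simp add: divide_ennreal_def ennreal_mult_top)
next
  case False
  then show ?thesis using assms by (simp add: divide_ennreal)
qed

lemma ennreal_divide_antimono:
  assumes "0 < a" "0 \<le> x" "x \<le> y"
  shows "ennreal a / ennreal y \<le> ennreal a / ennreal x"
proof (cases "x = 0")
  case True
  then show ?thesis using assms by simp
next
  case False
  then show ?thesis using assms by (simp add: divide_ennreal ennreal_leI divide_left_mono)
qed

text \<open>The two occurrences of the number of points cancel. Only this finite positive factor is
  cancelled, so the identity also holds when \<open>Lq\<close> is 0.\<close>

lemma rho_eq_L_norm_U_norm:
  assumes "xs \<noteq> []"
  shows "rho xs bs = L_norm xs bs * U_norm xs bs"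
proof -
  let ?n = "ennreal (real (length xs))"
  have "?n * inverse ?n = 1"
    using assms by (simp add: inverse_ennreal ennreal_mult[symmetric])
  then have "ennreal (Uq xs bs) * inverse (ennreal (Lq xs bs))
    = (?n * inverse ?n) * (ennreal (Uq xs bs) * inverse (ennreal (Lq xs bs)))" by simp
  then show ?thesis
    unfolding rho_def L_norm_def U_norm_def divide_ennreal_def by (simp only: mult_ac)
qed

lemma real_root_prod:
  "0 < n \<Longrightarrow> root n (\<Prod>i\<in>I. f i) = (\<Prod>i\<in>I. root n (f i))"
  by (induction I rule: infinite_finite_induct) (auto simp: real_root_mult)

text \<open>One vanishing \<open>d i\<close> makes both sides infinite. Otherwise everything is
  real, nested roots multiply their degrees, and the root of degree \<open>card I\<close> takes
  \<open>s ^ card I\<close> back to \<open>s\<close>.\<close>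

lemma ennreal_root_prod_divide:
  fixes d :: "'i \<Rightarrow> real"
  assumes I: "finite I" "I \<noteq> {}" and l: "0 < l" and d: "\<And>i. i \<in> I \<Longrightarrow> 0 \<le> d i" and s: "0 < s"
  shows "ennreal_root (card I) (\<Prod>i\<in>I. ennreal s / ennreal (root l (d i)))
    = ennreal s / ennreal (root (card I * l) (\<Prod>i\<in>I. d i))"
proof (cases "\<exists>i\<in>I. d i = 0")
  case True
  then obtain i where i: "i \<in> I" "d i = 0" by blast
  have top: "ennreal s / 0 = \<infinity>" using s by simp
  \<comment> \<open>In \<open>ennreal\<close> infinity times 0 is 0, so the remaining factors must
    be nonzero for the product to be infinite.\<close>
  have ne: "ennreal s / ennreal (root l (d j)) \<noteq> 0" for j
    using s by (simp add: divide_ennreal_def)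
  have "(\<Prod>j\<in>I. ennreal s / ennreal (root l (d j)))
    = \<infinity> * (\<Prod>j\<in>I - {i}. ennreal s / ennreal (root l (d j)))"
    using I(1) i top by (simp add: prod.remove[of I i])
  also have "\<dots> = \<infinity>"
    using I(1) ne by (simp add: ennreal_top_mult)
  finally have "(\<Prod>j\<in>I. ennreal s / ennreal (root l (d j))) = \<infinity>" .
  moreover have "(\<Prod>j\<in>I. d j) = 0" using I(1) i by auto
  ultimately show ?thesis using top by (simp add: ennreal_root_def infinity_ennreal_def)
next
  case False
  then have pos: "0 < d i" if "i \<in> I" for i using d[OF that] that by force
  have card: "0 < card I" using I by (simp add: card_gt_0_iff)
  have "(\<Prod>i\<in>I. ennreal s / ennreal (root l (d i))) = (\<Prod>i\<in>I. ennreal (s / root l (d i)))"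
    using pos l s by (intro prod.cong refl divide_ennreal) (auto simp: real_root_gt_zero)
  also have "\<dots> = ennreal (\<Prod>i\<in>I. s / root l (d i))"
    using pos l s by (intro prod_ennreal) (auto simp: real_root_gt_zero less_imp_le)
  finally have eq: "(\<Prod>i\<in>I. ennreal s / ennreal (root l (d i))) = ennreal (\<Prod>i\<in>I. s / root l (d i))" .
  have nonneg: "0 \<le> (\<Prod>i\<in>I. s / root l (d i))"
    using pos l s by (intro prod_nonneg) (auto simp: real_root_gt_zero less_imp_le)
  have "(\<Prod>i\<in>I. s / root l (d i)) = s ^ card I / root l (\<Prod>i\<in>I. d i)"
    using l by (simp add: prod_dividef real_root_prod)
  then have "root (card I) (\<Prod>i\<in>I. s / root l (d i)) = s / root (card I * l) (\<Prod>i\<in>I. d i)"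
    using card s by (simp add: real_root_divide real_root_power_cancel real_root_mult_exp)
  moreover have "0 < root (card I * l) (\<Prod>i\<in>I. d i)"
    using pos card l by (simp add: real_root_gt_zero prod_pos)
  ultimately show ?thesis
    unfolding eq using nonneg s by (simp add: ennreal_root_def divide_ennreal infinity_ennreal_def)
qed

lemma Lq_nonneg: "0 \<le> Lq ys cs" by (simp add: Lq_def)

lemma Uq_nonneg: "0 \<le> Uq ys cs" by (simp add: Uq_def)

section \<open>The multi-tiling and the enumeration of \<open>E\<close> coset by coset\<close>

locale multi_tiling = comm_group G
  for G :: "('a, 'b) monoid_scheme" (structure) +
  fixes H E :: "'a set"
    and k :: "nat \<Rightarrow> 'a set"
    and g :: "nat \<Rightarrow> 'a"
    and m l :: nat
    and B\<^sub>H B :: "('a \<Rightarrow> complex) set"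
    and ext :: "('a \<Rightarrow> complex) \<Rightarrow> ('a \<Rightarrow> complex)"
    and F F' :: "nat \<Rightarrow> 'a set"
    and xs :: "'a list" and bs hs :: "('a \<Rightarrow> complex) list" and fs :: "nat \<Rightarrow> 'a list"
  assumes fin: "finite (carrier G)"
    and H: "subgroup H G"
    and k: "bij_betw k {1..m} (rcosets H)"
    and E: "E \<subseteq> carrier G" "E \<noteq> {}"
    and F: "\<And>i. i \<in> {1..m} \<Longrightarrow> F i = E \<inter> k i"
    and card_F: "\<And>i. i \<in> {1..m} \<Longrightarrow> card (F i) = l"
    and g: "\<And>i. i \<in> {1..m} \<Longrightarrow> g i \<in> k i"
    and F': "\<And>i. i \<in> {1..m} \<Longrightarrow> F' i = F i #> inv (g i)"
    and B\<^sub>H: "B\<^sub>H \<subseteq> characters (G\<lparr>carrier := H\<rparr>)" "card B\<^sub>H = l"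
    and ext: "\<And>\<phi>. \<phi> \<in> B\<^sub>H \<Longrightarrow> ext \<phi> \<in> characters G \<and> restrict (ext \<phi>) H = \<phi>"
    and B: "B = {char_mult G (ext \<phi>) \<psi> | \<phi> \<psi>. \<phi> \<in> B\<^sub>H \<and> \<psi> \<in> annihilator G H}"
    and xs: "enumerates xs E" and bs: "enumerates bs B" and hs: "enumerates hs B\<^sub>H"
    and fs: "\<And>i. i \<in> {1..m} \<Longrightarrow> enumerates (fs i) (F' i)"
begin

lemma H_carrier: "h \<in> H \<Longrightarrow> h \<in> carrier G"
  using subgroup.mem_carrier[OF H] .

lemma k_carrier: "i \<in> {1..m} \<Longrightarrow> x \<in> k i \<Longrightarrow> x \<in> carrier G"
  using bij_betw_apply[OF k] rcosets_part_G[OF H] by blast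

lemma g_carrier: "i \<in> {1..m} \<Longrightarrow> g i \<in> carrier G"
  using k_carrier g by blast

lemma E_cover: "x \<in> E \<Longrightarrow> \<exists>i\<in>{1..m}. x \<in> F i"
proof -
  assume x: "x \<in> E"
  have "carrier G = (\<Union>i\<in>{1..m}. k i)"
    using k rcosets_part_G[OF H] by (simp add: bij_betw_def)
  then show ?thesis using x E(1) F by blast
qed

lemma k_disjoint:
  assumes "i \<in> {1..m}" "j \<in> {1..m}" "x \<in> k i" "x \<in> k j"
  shows "i = j"
proof (rule inj_onD[OF bij_betw_imp_inj_on[OF k] _ assms(1,2)], rule ccontr)
  assume "k i \<noteq> k j"
  then have "disjnt (k i) (k j)"
    using pairwiseD[OF rcos_disjoint[OF H]] bij_betw_apply[OF k] assms(1,2) by metis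
  then show False using assms(3,4) by (auto simp: disjnt_def)
qed

lemma k_eq: "i \<in> {1..m} \<Longrightarrow> k i = H #> g i"
proof -
  assume i: "i \<in> {1..m}"
  then obtain y where "y \<in> carrier G" "k i = H #> y"
    using bij_betw_apply[OF k i] by (auto simp: RCOSETS_def)
  then show ?thesis using repr_independence[of "g i" H y] g[OF i] H by simp
qed

lemma F'_subset_H: "i \<in> {1..m} \<Longrightarrow> F' i \<subseteq> H"
proof
  fix x assume i: "i \<in> {1..m}" and "x \<in> F' i"
  then obtain y where y: "y \<in> k i" "x = y \<otimes> inv (g i)"
    using F F' by (auto simp: r_coset_def)
  then obtain h where "h \<in> H" "y = h \<otimes> g i" using k_eq[OF i] by (auto simp: r_coset_def)
  then show "x \<in> H" using y g_carrier[OF i] H_carrier by (simp add: m_assoc)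
qed

lemma bij_translate: "i \<in> {1..m} \<Longrightarrow> bij_betw (\<lambda>x. x \<otimes> g i) (F' i) (F i)"
proof -
  assume i: "i \<in> {1..m}"
  have Fc: "x \<in> carrier G" if "x \<in> F i" for x using F[OF i] E(1) that by blast
  have gc: "g i \<in> carrier G" using g_carrier[OF i] .
  show ?thesis
    by (rule bij_betw_byWitness[where f' = "\<lambda>x. x \<otimes> inv (g i)"])
       (use Fc gc in \<open>auto simp: F'[OF i] r_coset_def m_assoc\<close>)
qed

lemma length_fs: "i \<in> {1..m} \<Longrightarrow> length (fs i) = l"
  using fs[of i] card_F[of i] bij_betw_same_card[OF bij_translate, of i]
  by (simp add: enumerates_def distinct_card[symmetric])

lemma length_hs: "length hs = l"
  using hs B\<^sub>H(2) by (auto simp: enumerates_def distinct_card[symmetric])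

lemma finite_E: "finite E" using finite_subset[OF E(1) fin] .

lemma m_pos: "0 < m" using E_cover E(2) by fastforce

lemma l_pos: "0 < l"
proof -
  obtain x i where "i \<in> {1..m}" "x \<in> F i" using E_cover E(2) by blast
  then show ?thesis
    using card_F[of i] F[of i] finite_E by (auto simp: card_gt_0_iff)
qed

text \<open>The \<open>a mod l\<close>-th point of the translated piece with number
  \<open>a div l\<close>, moved back into its coset. Matrix blocks count from 0 but cosets from 1,
  whence \<open>Suc\<close>.\<close>

definition pt :: "nat \<Rightarrow> 'a" where
  "pt a = (fs (Suc (a div l)) ! (a mod l)) \<otimes> g (Suc (a div l))"

lemma div_index: "a < m * l \<Longrightarrow> a div l < m \<and> a mod l < l \<and> Suc (a div l) \<in> {1..m}"
  using l_pos by (auto simp: less_mult_imp_div_less Suc_le_eq)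

lemma fs_nth:
  assumes "i \<in> {1..m}" "r < l"
  shows "fs i ! r \<in> F' i"
  using fs[OF assms(1)] nth_mem[of r "fs i"] length_fs[OF assms(1)] assms(2)
  by (simp add: enumerates_def)

lemma pt_mem:
  assumes "a < m * l"
  shows "pt a \<in> F (Suc (a div l))"
proof -
  have a: "Suc (a div l) \<in> {1..m}" "a mod l < l" using div_index[OF assms] by auto
  show ?thesis unfolding pt_def by (rule bij_betw_apply[OF bij_translate[OF a(1)] fs_nth[OF a]])
qed

text \<open>Disjointness of the cosets recovers the block number from the point; injectivity of the
  translation and distinctness of \<open>fs i\<close> then recover the offset.\<close>

lemma bij_pt: "bij_betw pt {..<m * l} E"
proof (rule bij_betwI')
  fix a b assume a: "a \<in> {..<m * l}" and b: "b \<in> {..<m * l}"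
  let ?i = "\<lambda>a. Suc (a div l)"
  have ia: "?i a \<in> {1..m}" "a mod l < l" and ib: "?i b \<in> {1..m}" "b mod l < l"
    using a b div_index by auto
  show "pt a = pt b \<longleftrightarrow> a = b"
  proof
    assume eq: "pt a = pt b"
    have "pt a \<in> k (?i a)" "pt a \<in> k (?i b)"
      using pt_mem[of a] pt_mem[of b] a b eq F[OF ia(1)] F[OF ib(1)] by auto
    then have i: "?i a = ?i b" by (rule k_disjoint[OF ia(1) ib(1)])
    then have "fs (?i a) ! (a mod l) \<otimes> g (?i a) = fs (?i a) ! (b mod l) \<otimes> g (?i a)"
      using eq by (simp add: pt_def)
    then have "fs (?i a) ! (a mod l) = fs (?i a) ! (b mod l)"
      by (rule inj_onD[OF bij_betw_imp_inj_on[OF bij_translate[OF ia(1)]] _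
          fs_nth[OF ia(1,2)] fs_nth[OF ia(1) ib(2)]])
    then have "a mod l = b mod l"
      using fs[OF ia(1)] length_fs[OF ia(1)] ia ib by (simp add: enumerates_def nth_eq_iff_index_eq)
    then show "a = b" using i by (metis Suc_inject div_mult_mod_eq)
  qed simp
next
  fix a assume "a \<in> {..<m * l}"
  then show "pt a \<in> E"
    using pt_mem[of a] div_index[of a] F[of "Suc (a div l)"] by simp
next
  fix x assume "x \<in> E"
  then obtain i where i: "i \<in> {1..m}" "x \<in> F i" using E_cover by blast
  then obtain y where y: "y \<in> F' i" "x = y \<otimes> g i"
    using bij_translate[OF i(1)] by (auto simp: bij_betw_def)
  then obtain r where r: "r < l" "y = fs i ! r"
    using fs[OF i(1)] length_fs[OF i(1)] by (metis enumerates_def in_set_conv_nth)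
  let ?a = "(i - 1) * l + r"
  have "?a div l = i - 1" "?a mod l = r" using r(1) by auto
  then have "x = pt ?a" using y(2) r(2) i(1) by (simp add: pt_def)
  moreover have "?a < m * l"
  proof -
    have "?a < (i - 1) * l + l" using r(1) by simp
    also have "\<dots> = i * l" using i(1) by (cases i) auto
    also have "\<dots> \<le> m * l" using i(1) by simp
    finally show ?thesis .
  qed
  ultimately show "\<exists>a\<in>{..<m * l}. x = pt a" by blast
qed

lemma length_xs: "length xs = m * l"
  using bij_betw_same_card[OF bij_pt] xs by (auto simp: enumerates_def distinct_card[symmetric])

lemma B_character: "b \<in> B \<Longrightarrow> b \<in> characters G"
  using B ext char_mult_characters by (auto simp: annihilator_def)

lemma restrict_char_mult:
  assumes "\<phi> \<in> B\<^sub>H" "\<psi> \<in> annihilator G H"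
  shows "restrict (char_mult G (ext \<phi>) \<psi>) H = \<phi>"
proof -
  have "restrict (char_mult G (ext \<phi>) \<psi>) H = restrict (ext \<phi>) H"
    using assms(2) H_carrier by (intro restrict_ext) (simp add: char_mult_apply annihilator_def)
  then show ?thesis using ext[OF assms(1)] by simp
qed

lemma B_restrict: "b \<in> B \<Longrightarrow> restrict b H \<in> B\<^sub>H"
  using restrict_char_mult B by auto

text \<open>Restriction to \<open>H\<close> recovers \<phi> from the product, and multiplying by the
  conjugate of \<open>ext \<phi>\<close> then recovers \<psi>. So \<open>B\<close> has l times the
  size of the annihilator many elements, which makes the matrix square.\<close>

lemma length_bs: "length bs = m * l"
proof -
  let ?f = "\<lambda>(\<phi>, \<psi>). char_mult G (ext \<phi>) \<psi>"
  have "B = ?f ` (B\<^sub>H \<times> annihilator G H)" using B by auto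
  moreover have "inj_on ?f (B\<^sub>H \<times> annihilator G H)"
  proof (rule inj_onI, clarify)
    fix \<phi> \<psi> \<phi>' \<psi>'
    assume *: "\<phi> \<in> B\<^sub>H" "\<psi> \<in> annihilator G H" "\<phi>' \<in> B\<^sub>H" "\<psi>' \<in> annihilator G H"
      and eq: "char_mult G (ext \<phi>) \<psi> = char_mult G (ext \<phi>') \<psi>'"
    have \<phi>: "\<phi> = \<phi>'" using restrict_char_mult * eq by metis
    have "\<psi> \<in> characters G" "\<psi>' \<in> characters G" using * by (auto simp: annihilator_def)
    then have "\<psi> = \<psi>'" using char_mult_cnj_cancel(2) eq ext[OF *(1)] unfolding \<phi> by metis
    with \<phi> show "\<phi> = \<phi>' \<and> \<psi> = \<psi>'" by simp
  qed
  ultimately have "card B = card (B\<^sub>H \<times> annihilator G H)" by (simp add: card_image)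
  also have "\<dots> = l * m"
    using card_annihilator[OF fin H] bij_betw_same_card[OF k] B\<^sub>H(2) by (simp add: card_cartesian_product)
  finally show ?thesis using bs by (auto simp: enumerates_def distinct_card[symmetric] mult.commute)
qed

section \<open>The factorization of the character matrix\<close>

definition block :: "nat \<Rightarrow> complex mat" where
  "block i = char_mat (fs (Suc i)) hs"

definition blocks :: "complex mat list" where
  "blocks = map block [0..<m]"

text \<open>\<open>xs\<close> lists \<open>E\<close> in an arbitrary order; this matrix passes to it
  from the order of \<open>pt\<close>.\<close>

definition perm_mat :: "complex mat" where
  "perm_mat = mat (m * l) (m * l) (\<lambda>(p, a). if xs ! p = pt a then 1 else 0)"

text \<open>The matrix \<open>V\<close> of the overview: row \<open>a\<close> stands for the coset
  number \<open>a div l\<close> and the character \<open>hs ! (a mod l)\<close>. Columns follow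
  \<open>bs\<close>, so only rows need a permutation.\<close>

definition fourier_mat :: "complex mat" where
  "fourier_mat = mat (m * l) (m * l) (\<lambda>(a, q).
     if restrict (bs ! q) H = hs ! (a mod l) then (bs ! q) (g (Suc (a div l))) else 0)"

lemma blocks_carrier: "\<forall>A\<in>set blocks. A \<in> carrier_mat l l"
  by (auto simp: blocks_def block_def char_mat_def length_fs length_hs)

lemma length_blocks: "length blocks = m"
  by (simp add: blocks_def)

lemma blocks_nth: "i < m \<Longrightarrow> blocks ! i = char_mat (fs (Suc i)) hs"
  by (simp add: blocks_def block_def)

lemma factor_carriers:
  "perm_mat \<in> carrier_mat (m * l) (m * l)"
  "fourier_mat \<in> carrier_mat (m * l) (m * l)"
  "diag_block_mat blocks \<in> carrier_mat (m * l) (m * l)"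
  using diag_block_mat_carrier[OF blocks_carrier]
  by (auto simp: perm_mat_def fourier_mat_def length_blocks)

lemma bs_nth: "q < m * l \<Longrightarrow> bs ! q \<in> B"
  using bs length_bs by (auto simp: enumerates_def)

text \<open>Each column of \<open>fourier_mat\<close> thus has exactly one nonzero entry per coset,
  always at the same offset \<open>r\<close>.\<close>

lemma hs_index:
  assumes "q < m * l"
  obtains r where "r < l" "\<And>r'. r' < l \<Longrightarrow> restrict (bs ! q) H = hs ! r' \<longleftrightarrow> r' = r"
proof -
  have "restrict (bs ! q) H \<in> set hs"
    using B_restrict[OF bs_nth[OF assms]] hs by (simp add: enumerates_def)
  then obtain r where "r < l" "restrict (bs ! q) H = hs ! r"
    using length_hs by (metis in_set_conv_nth)
  moreover have "hs ! r = hs ! r' \<longleftrightarrow> r' = r" if "r' < l" for r'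
    using calculation that hs length_hs by (auto simp: enumerates_def nth_eq_iff_index_eq)
  ultimately show ?thesis using that by metis
qed

text \<open>The block diagonal factor leaves only the coset of \<open>a\<close>, and the restriction
  of the character leaves only one offset in it, so the sum collapses to one term.\<close>

lemma diag_fourier_index:
  assumes a: "a < m * l" and q: "q < m * l"
  shows "(diag_block_mat blocks * fourier_mat) $$ (a, q) = (bs ! q) (pt a)"
proof -
  let ?i = "a div l" and ?b = "bs ! q"
  let ?f = "fs (Suc ?i) ! (a mod l)"
  obtain r where r: "r < l" "\<And>r'. r' < l \<Longrightarrow> restrict ?b H = hs ! r' \<longleftrightarrow> r' = r"
    using hs_index[OF q] by blast
  have ia: "?i < m" "a mod l < l" "Suc ?i \<in> {1..m}" using div_index[OF a] by auto
  have f: "?f \<in> H" using fs_nth[OF ia(3,2)] F'_subset_H[OF ia(3)] by blast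
  have "(diag_block_mat blocks * fourier_mat) $$ (a, q)
    = (\<Sum>a'<m * l. diag_block_mat blocks $$ (a, a') * fourier_mat $$ (a', q))"
    using a q factor_carriers by (auto simp: scalar_prod_def lessThan_atLeast0 intro!: sum.cong)
  also have "\<dots> = (\<Sum>a'<m * l. if a' div l = ?i then
      (if restrict ?b H = hs ! (a' mod l) then (hs ! (a' mod l)) ?f * ?b (g (Suc (a' div l))) else 0) else 0)"
  proof (rule sum.cong[OF refl])
    fix a' assume "a' \<in> {..<m * l}"
    then show "diag_block_mat blocks $$ (a, a') * fourier_mat $$ (a', q) = (if a' div l = ?i then
      (if restrict ?b H = hs ! (a' mod l) then (hs ! (a' mod l)) ?f * ?b (g (Suc (a' div l))) else 0) else 0)"
      using a q ia div_index[of a'] length_fs[OF ia(3)] length_hs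
        diag_block_mat_index[OF blocks_carrier, of a a', unfolded length_blocks]
      by (simp add: fourier_mat_def blocks_nth char_mat_def)
  qed
  also have "\<dots> = (\<Sum>i<m. \<Sum>r'<l. if i = ?i then
      (if restrict ?b H = hs ! r' then (hs ! r') ?f * ?b (g (Suc i)) else 0) else 0)"
    by (rule sum_div_mod)
  also have "\<dots> = (\<Sum>i<m. if i = ?i then (\<Sum>r'<l.
      if restrict ?b H = hs ! r' then (hs ! r') ?f * ?b (g (Suc i)) else 0) else 0)"
    by (intro sum.cong) auto
  also have "\<dots> = (\<Sum>r'<l. if restrict ?b H = hs ! r' then (hs ! r') ?f * ?b (g (Suc ?i)) else 0)"
    using ia(1) by simp
  also have "\<dots> = (\<Sum>r'<l. if r' = r then (hs ! r') ?f * ?b (g (Suc ?i)) else 0)"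
    using r(2) by (intro sum.cong) auto
  also have "\<dots> = restrict ?b H ?f * ?b (g (Suc ?i))"
    using r(1) r(2)[OF r(1)] by simp
  \<comment> \<open>As \<open>?f\<close> lies in \<open>H\<close>, the restriction may be dropped,
    and multiplicativity joins the two values into the value at \<open>?f\<close> times the
    representative.\<close>
  also have "\<dots> = ?b (pt a)"
    using f charactersD(2)[OF B_character[OF bs_nth[OF q]] H_carrier[OF f] g_carrier[OF ia(3)]]
    by (simp add: pt_def)
  finally show ?thesis .
qed

lemma char_mat_factorization:
  "char_mat xs bs = perm_mat * (diag_block_mat blocks * fourier_mat)"
proof (rule eq_matI)
  fix p q assume "p < dim_row (perm_mat * (diag_block_mat blocks * fourier_mat))"
    "q < dim_col (perm_mat * (diag_block_mat blocks * fourier_mat))"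
  then have p: "p < m * l" and q: "q < m * l" using factor_carriers by auto
  have "xs ! p \<in> E" using xs p length_xs by (auto simp: enumerates_def)
  then obtain a where a: "a < m * l" "xs ! p = pt a"
    using bij_pt by (auto simp: bij_betw_def)
  have uniq: "xs ! p = pt a' \<longleftrightarrow> a' = a" if "a' < m * l" for a'
    using a that bij_betw_imp_inj_on[OF bij_pt] by (auto simp: inj_on_def)
  have "(perm_mat * (diag_block_mat blocks * fourier_mat)) $$ (p, q)
    = (\<Sum>a'<m * l. perm_mat $$ (p, a') * (diag_block_mat blocks * fourier_mat) $$ (a', q))"
    using p q factor_carriers by (auto simp: scalar_prod_def lessThan_atLeast0 simp del: index_mult_mat(1) intro!: sum.cong) (simp add: scalar_prod_def)
  also have "\<dots> = (\<Sum>a'<m * l. if a' = a then (bs ! q) (pt a') else 0)"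
    using p q uniq by (intro sum.cong) (auto simp: perm_mat_def diag_fourier_index)
  also have "\<dots> = (bs ! q) (xs ! p)" using a by simp
  finally show "char_mat xs bs $$ (p, q) = (perm_mat * (diag_block_mat blocks * fourier_mat)) $$ (p, q)"
    using p q length_xs length_bs by (simp add: char_mat_def)
qed (use factor_carriers length_xs length_bs in \<open>auto simp: char_mat_def\<close>)

lemma perm_mat_unitary: "mat_adjoint perm_mat * perm_mat = 1\<^sub>m (m * l)"
proof (rule eq_matI)
  fix a b assume "a < dim_row (1\<^sub>m (m * l) :: complex mat)" "b < dim_col (1\<^sub>m (m * l) :: complex mat)"
  then have a: "a < m * l" and b: "b < m * l" by auto
  have "pt a \<in> set xs" using bij_betw_apply[OF bij_pt] a xs by (auto simp: enumerates_def)
  then obtain p where p: "p < m * l" "pt a = xs ! p" using length_xs by (metis in_set_conv_nth)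
  have uniq: "xs ! p' = pt a \<longleftrightarrow> p' = p" if "p' < m * l" for p'
    using p that xs length_xs by (simp add: enumerates_def nth_eq_iff_index_eq)
  have inj: "pt a = pt b \<longleftrightarrow> a = b"
    using a b bij_betw_imp_inj_on[OF bij_pt] by (auto simp: inj_on_def)
  have "(mat_adjoint perm_mat * perm_mat) $$ (a, b)
    = (\<Sum>p'<m * l. cnj (perm_mat $$ (p', a)) * perm_mat $$ (p', b))"
    using a b factor_carriers
    by (auto simp: scalar_prod_def mat_adjoint_index lessThan_atLeast0 intro!: sum.cong)
  also have "\<dots> = (\<Sum>p'<m * l. if p' = p then (if a = b then 1 else 0) else 0)"
    using a b uniq inj p(2) by (intro sum.cong) (auto simp: perm_mat_def)
  also have "\<dots> = 1\<^sub>m (m * l) $$ (a, b)" using a b p by simp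
  finally show "(mat_adjoint perm_mat * perm_mat) $$ (a, b) = 1\<^sub>m (m * l) $$ (a, b)" .
qed (use factor_carriers in auto)

text \<open>Since \<open>b\<close> and \<open>b'\<close> agree on \<open>H\<close>, the product of
  \<open>b'\<close> with the conjugate of \<open>b\<close> lies in the annihilator. It is trivial
  exactly for \<open>b = b'\<close>, and otherwise its sum over representatives is 0.\<close>

lemma sum_cnj_characters:
  assumes b: "b \<in> B" "b' \<in> B" "restrict b H = restrict b' H"
  shows "(\<Sum>i<m. cnj (b (g (Suc i))) * b' (g (Suc i))) = (if b = b' then of_nat m else 0)"
proof -
  let ?\<psi> = "char_mult G (char_cnj b) b'"
  have ch: "b \<in> characters G" "b' \<in> characters G" using b B_character by auto
  have eqH: "b h = b' h" if "h \<in> H" for h using fun_cong[OF b(3), of h] that by simp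
  have \<psi>: "?\<psi> \<in> annihilator G H"
    using ch eqH H_carrier unit_cnj_mult(1)[OF charactersD(1)[OF ch(2)]]
    by (auto simp: annihilator_def char_mult_characters char_cnj_characters char_mult_apply char_cnj_apply)
  have "(\<Sum>i<m. cnj (b (g (Suc i))) * b' (g (Suc i))) = (\<Sum>i\<in>{1..m}. ?\<psi> (g i))"
    by (rule sum.reindex_bij_witness[where i = "\<lambda>i. i - 1" and j = Suc])
       (use g_carrier in \<open>auto simp: char_mult_apply char_cnj_apply\<close>)
  also have "\<dots> = (if b = b' then of_nat m else 0)"
  proof (cases "b = b'")
    case True
    then have "?\<psi> (g i) = 1" if "i \<in> {1..m}" for i
      using unit_cnj_mult(1)[OF charactersD(1)[OF ch(2)]] g_carrier[OF that]
      by (simp add: char_mult_apply char_cnj_apply)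
    then show ?thesis using True by simp
  next
    case False
    \<comment> \<open>Both characters are extensional, so they must differ at a group
      element.\<close>
    then obtain x where x: "x \<in> carrier G" "b x \<noteq> b' x"
      using extensionalityI[OF charactersD(3)[OF ch(1)] charactersD(3)[OF ch(2)]] by blast
    have "?\<psi> x \<noteq> 1"
    proof
      assume "?\<psi> x = 1"
      then have "cnj (b x) * b' x = cnj (b x) * b x"
        using x unit_cnj_mult(1)[OF charactersD(1)[OF ch(1) x(1)]] by (simp add: char_mult_apply char_cnj_apply)
      moreover have "cnj (b x) \<noteq> 0" using charactersD(1)[OF ch(1) x(1)] by auto
      ultimately show False using x(2) by simp
    qed
    then show ?thesis
      using sum_annihilator_representatives[OF fin H k g \<psi> x(1)] False by simp
  qed
  finally show ?thesis .
qed

text \<open>Columns with different offsets \<open>r\<close> and \<open>t\<close> have no common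
  nonzero row. For equal offsets the inner product is the sum over representatives, which gives the
  constant m.\<close>

lemma fourier_mat_unitary:
  "mat_adjoint fourier_mat * fourier_mat = complex_of_real (real m) \<cdot>\<^sub>m 1\<^sub>m (m * l)"
proof (rule eq_matI)
  fix p q assume "p < dim_row (complex_of_real (real m) \<cdot>\<^sub>m 1\<^sub>m (m * l))"
    "q < dim_col (complex_of_real (real m) \<cdot>\<^sub>m 1\<^sub>m (m * l))"
  then have p: "p < m * l" and q: "q < m * l" by auto
  let ?b = "bs ! p" and ?b' = "bs ! q"
  let ?s = "\<lambda>i. cnj (?b (g (Suc i))) * ?b' (g (Suc i))"
  obtain r where r: "r < l" "\<And>r'. r' < l \<Longrightarrow> restrict ?b H = hs ! r' \<longleftrightarrow> r' = r"
    using hs_index[OF p] by blast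
  obtain t where t: "t < l" "\<And>r'. r' < l \<Longrightarrow> restrict ?b' H = hs ! r' \<longleftrightarrow> r' = t"
    using hs_index[OF q] by blast
  have rt: "r = t \<longleftrightarrow> restrict ?b H = restrict ?b' H" using r t by metis
  have "(mat_adjoint fourier_mat * fourier_mat) $$ (p, q)
    = (\<Sum>a<m * l. cnj (fourier_mat $$ (a, p)) * fourier_mat $$ (a, q))"
    using p q factor_carriers
    by (auto simp: scalar_prod_def mat_adjoint_index lessThan_atLeast0 intro!: sum.cong)
  also have "\<dots> = (\<Sum>a<m * l. if a mod l = r then (if r = t then ?s (a div l) else 0) else 0)"
    using p q r t l_pos by (intro sum.cong) (auto simp: fourier_mat_def)
  also have "\<dots> = (\<Sum>i<m. \<Sum>r'<l. if r' = r then (if r = t then ?s i else 0) else 0)"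
    by (rule sum_div_mod)
  also have "\<dots> = (if r = t then \<Sum>i<m. ?s i else 0)" using r(1) by simp
  also have "\<dots> = (if ?b = ?b' then of_nat m else 0)"
    using sum_cnj_characters[OF bs_nth[OF p] bs_nth[OF q]] rt by auto
  also have "?b = ?b' \<longleftrightarrow> p = q"
    using bs length_bs p q by (simp add: enumerates_def nth_eq_iff_index_eq)
  finally show "(mat_adjoint fourier_mat * fourier_mat) $$ (p, q)
    = (complex_of_real (real m) \<cdot>\<^sub>m 1\<^sub>m (m * l)) $$ (p, q)" using p q by simp
qed (use factor_carriers in auto)

section \<open>Transfer of singular values, norm and determinant to \<open>E\<close>\<close>

lemma n_pos: "0 < m * l" using m_pos l_pos by simp

lemma diag_fourier_carrier: "diag_block_mat blocks * fourier_mat \<in> carrier_mat (m * l) (m * l)"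
  using factor_carriers by auto

lemma set_blocks: "set blocks = (\<lambda>i. char_mat (fs i) hs) ` {1..m}"
proof -
  have "{1..m} = Suc ` {0..<m}"
    by (simp add: image_Suc_atLeastLessThan atLeastLessThanSuc_atLeastAtMost)
  then show ?thesis by (simp only: blocks_def block_def[abs_def] image_image set_map set_upt)
qed

lemma singular_values_char_mat:
  "singular_values (char_mat xs bs)
    = (\<Union>i\<in>{1..m}. (\<lambda>s. sqrt (real m) * s) ` singular_values (char_mat (fs i) hs))"
proof -
  have "singular_values (char_mat xs bs) = (\<lambda>s. sqrt (real m) * s) ` singular_values (diag_block_mat blocks)"
    unfolding char_mat_factorization
      singular_values_left_unitary[OF factor_carriers(1) diag_fourier_carrier perm_mat_unitary]
    using m_pos by (intro singular_values_right_scaled_unitary[OF factor_carriers(3,2) _ fourier_mat_unitary]) simp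
  then show ?thesis
    unfolding singular_values_diag_block[OF blocks_carrier] set_blocks by (simp add: image_UN)
qed

lemma char_mat_fs_carrier: "i \<in> {1..m} \<Longrightarrow> char_mat (fs i) hs \<in> carrier_mat l l"
  by (simp add: char_mat_def length_fs length_hs)

lemma sigma_min_fs:
  assumes "i \<in> {1..m}"
  shows "sigma_min (char_mat (fs i) hs) \<in> singular_values (char_mat (fs i) hs)"
  unfolding sigma_min_def using char_mat_fs_carrier[OF assms] l_pos
  by (intro Min_in finite_singular_values singular_values_nonempty)

lemma char_mat_carrier: "char_mat xs bs \<in> carrier_mat (m * l) (m * l)"
  by (simp add: char_mat_def length_xs length_bs)

text \<open>Each singular value of a block, times \<open>sqrt m\<close>, is one of the large matrix.
  Together with the attainment in \<open>Lq_eq\<close> this is the form in which a maximum of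
  reciprocals is verified later.\<close>

lemma Lq_le:
  assumes i: "i \<in> {1..m}"
  shows "Lq xs bs \<le> real m * Lq (fs i) hs"
proof -
  have fin: "finite (singular_values (char_mat xs bs))"
    using finite_singular_values[OF char_mat_carrier] .
  have "sqrt (real m) * sigma_min (char_mat (fs i) hs) \<in> singular_values (char_mat xs bs)"
    unfolding singular_values_char_mat using sigma_min_fs[OF i] i by blast
  then have "sigma_min (char_mat xs bs) \<le> sqrt (real m) * sigma_min (char_mat (fs i) hs)"
    unfolding sigma_min_def[of "char_mat xs bs"] using fin by (intro Min_le)
  \<comment> \<open>Squaring preserves the inequality only from a nonnegative smaller side; the
    minimum is itself a singular value.\<close>
  moreover have "0 \<le> sigma_min (char_mat xs bs)"
    using Min_in[OF fin singular_values_nonempty[OF char_mat_carrier n_pos]]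
    unfolding sigma_min_def by (simp add: singular_values_def)
  ultimately have "(sigma_min (char_mat xs bs))\<^sup>2 \<le> (sqrt (real m) * sigma_min (char_mat (fs i) hs))\<^sup>2"
    by (rule power_mono)
  then show ?thesis by (simp add: Lq_def power_mult_distrib)
qed

lemma Lq_eq: "\<exists>i\<in>{1..m}. Lq xs bs = real m * Lq (fs i) hs"
proof -
  have "sigma_min (char_mat xs bs) \<in> singular_values (char_mat xs bs)"
    unfolding sigma_min_def
    using finite_singular_values[OF char_mat_carrier] singular_values_nonempty[OF char_mat_carrier n_pos]
    by (rule Min_in)
  then obtain i s where i: "i \<in> {1..m}" and s: "s \<in> singular_values (char_mat (fs i) hs)"
    and eq: "sigma_min (char_mat xs bs) = sqrt (real m) * s"
    unfolding singular_values_char_mat by blast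
  have "sigma_min (char_mat (fs i) hs) \<le> s"
    unfolding sigma_min_def using finite_singular_values[OF char_mat_fs_carrier[OF i]] s by (rule Min_le)
  moreover have "0 \<le> sigma_min (char_mat (fs i) hs)"
    using sigma_min_fs[OF i] by (simp add: singular_values_def)
  ultimately have "(sigma_min (char_mat (fs i) hs))\<^sup>2 \<le> s\<^sup>2" by (rule power_mono)
  then have "real m * Lq (fs i) hs \<le> Lq xs bs"
    by (simp add: Lq_def eq power_mult_distrib mult_left_mono)
  then show ?thesis using Lq_le[OF i] i by (intro bexI[of _ i]) auto
qed

lemma op_norm2_char_mat:
  "op_norm2 (char_mat xs bs) = sqrt (real m) * (MAX i\<in>{1..m}. op_norm2 (char_mat (fs i) hs))"
proof -
  have "op_norm2 (char_mat xs bs) = sqrt (real m) * op_norm2 (diag_block_mat blocks)"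
    unfolding char_mat_factorization
      op_norm2_left_unitary[OF factor_carriers(1) diag_fourier_carrier n_pos perm_mat_unitary]
    using m_pos n_pos
    by (intro op_norm2_right_scaled_unitary[OF factor_carriers(3,2) _ _ fourier_mat_unitary]) auto
  also have "op_norm2 (diag_block_mat blocks) = Max (op_norm2 ` set blocks)"
    using length_blocks m_pos by (intro op_norm2_diag_block[OF blocks_carrier l_pos]) auto
  finally show ?thesis unfolding set_blocks by (simp add: image_image)
qed

lemma Uq_ge:
  assumes i: "i \<in> {1..m}"
  shows "real m * Uq (fs i) hs \<le> Uq xs bs"
proof -
  have "op_norm2 (char_mat (fs i) hs) \<le> (MAX i\<in>{1..m}. op_norm2 (char_mat (fs i) hs))"
    using i by (intro Max_ge) auto
  then have "(op_norm2 (char_mat (fs i) hs))\<^sup>2 \<le> (MAX i\<in>{1..m}. op_norm2 (char_mat (fs i) hs))\<^sup>2"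
    using op_norm2_nonneg[OF char_mat_fs_carrier[OF i] l_pos] by (rule power_mono)
  then show ?thesis by (simp add: Uq_def op_norm2_char_mat power_mult_distrib mult_left_mono)
qed

lemma Uq_eq: "\<exists>i\<in>{1..m}. Uq xs bs = real m * Uq (fs i) hs"
proof -
  have "(MAX i\<in>{1..m}. op_norm2 (char_mat (fs i) hs)) \<in> (\<lambda>i. op_norm2 (char_mat (fs i) hs)) ` {1..m}"
    using m_pos by (intro Max_in) auto
  then obtain i where "i \<in> {1..m}"
    "(MAX i\<in>{1..m}. op_norm2 (char_mat (fs i) hs)) = op_norm2 (char_mat (fs i) hs)" by auto
  then show ?thesis by (intro bexI[of _ i]) (auto simp: Uq_def op_norm2_char_mat power_mult_distrib)
qed

text \<open>The permutation contributes a determinant of modulus 1 and \<open>fourier_mat\<close>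
  one of modulus \<open>sqrt m ^ (m * l)\<close>.\<close>

lemma Dq_eq: "Dq xs bs = sqrt (real m) ^ (m * l) * (\<Prod>i\<in>{1..m}. Dq (fs i) hs)"
proof -
  have one: "mat_adjoint perm_mat * perm_mat = complex_of_real 1 \<cdot>\<^sub>m 1\<^sub>m (m * l)"
    unfolding perm_mat_unitary by (intro eq_matI) auto
  have "det (char_mat xs bs) = det perm_mat * (det (diag_block_mat blocks) * det fourier_mat)"
    unfolding char_mat_factorization det_mult[OF factor_carriers(1) diag_fourier_carrier]
      det_mult[OF factor_carriers(3,2)] ..
  then have "Dq xs bs = cmod (det (diag_block_mat blocks)) * sqrt (real m) ^ (m * l)"
    using cmod_det_scaled_unitary[OF factor_carriers(1) _ one]
      cmod_det_scaled_unitary[OF factor_carriers(2) _ fourier_mat_unitary]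
    by (simp add: Dq_def norm_mult)
  also have "det (diag_block_mat blocks) = (\<Prod>i<m. det (block i))"
    unfolding det_diag_block[OF blocks_carrier]
    by (simp add: blocks_def prod.distinct_set_conv_list[symmetric] comp_def lessThan_atLeast0)
  also have "cmod (\<Prod>i<m. det (block i)) = (\<Prod>i<m. Dq (fs (Suc i)) hs)"
    by (simp add: prod_norm[symmetric] Dq_def block_def)
  also have "\<dots> = (\<Prod>i\<in>{1..m}. Dq (fs i) hs)"
    by (rule prod.reindex_bij_witness[where i = "\<lambda>i. i - 1" and j = Suc]) auto
  finally show ?thesis by simp
qed

text \<open>Expanding l / L to (ml) / (mL) gives every block the numerator of the large matrix;
  division then turns the smallest \<open>Lq\<close> into the largest quotient, infinite if some
  block is singular.\<close>

lemma L_norm_eq: "L_norm xs bs = (MAX i\<in>{1..m}. L_norm (fs i) hs)"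
proof (rule Max_eqI[symmetric])
  have eq: "L_norm (fs i) hs = ennreal (real (m * l)) / ennreal (real m * Lq (fs i) hs)" if "i \<in> {1..m}" for i
    using ennreal_divide_cancel_real[of "real m" "real l" "Lq (fs i) hs"] m_pos l_pos Lq_nonneg[of "fs i" hs]
    by (simp add: L_norm_def length_fs[OF that])
  show "y \<le> L_norm xs bs" if y: "y \<in> (\<lambda>i. L_norm (fs i) hs) ` {1..m}" for y
  proof -
    obtain i where i: "i \<in> {1..m}" "y = L_norm (fs i) hs" using y by blast
    show ?thesis
      unfolding i(2) eq[OF i(1)] L_norm_def[of xs] length_xs
      using n_pos by (intro ennreal_divide_antimono Lq_nonneg Lq_le[OF i(1)]) simp
  qed
  obtain i where "i \<in> {1..m}" "Lq xs bs = real m * Lq (fs i) hs" using Lq_eq by blast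
  then show "L_norm xs bs \<in> (\<lambda>i. L_norm (fs i) hs) ` {1..m}"
    by (intro image_eqI[of _ _ i]) (simp_all only: eq L_norm_def[of xs] length_xs)
qed simp

lemma U_norm_eq: "U_norm xs bs = (MAX i\<in>{1..m}. U_norm (fs i) hs)"
proof (rule Max_eqI[symmetric])
  have eq: "U_norm (fs i) hs = ennreal (real m * Uq (fs i) hs) / ennreal (real (m * l))" if "i \<in> {1..m}" for i
    using ennreal_divide_cancel_real[of "real m" "Uq (fs i) hs" "real l"] m_pos l_pos Uq_nonneg[of "fs i" hs]
    by (simp add: U_norm_def length_fs[OF that])
  show "y \<le> U_norm xs bs" if y: "y \<in> (\<lambda>i. U_norm (fs i) hs) ` {1..m}" for y
  proof -
    obtain i where i: "i \<in> {1..m}" "y = U_norm (fs i) hs" using y by blast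
    have "ennreal (real m * Uq (fs i) hs) \<le> ennreal (Uq xs bs)" using Uq_ge[OF i(1)] by (rule ennreal_leI)
    then show ?thesis
      unfolding i(2) eq[OF i(1)] U_norm_def[of xs] length_xs by (rule divide_right_mono_ennreal)
  qed
  obtain i where "i \<in> {1..m}" "Uq xs bs = real m * Uq (fs i) hs" using Uq_eq by blast
  then show "U_norm xs bs \<in> (\<lambda>i. U_norm (fs i) hs) ` {1..m}"
    by (intro image_eqI[of _ _ i]) (simp_all only: eq U_norm_def[of xs] length_xs)
qed simp

text \<open>The root of degree ml of the factor in \<open>Dq_eq\<close> is \<open>sqrt m\<close>,
  which cancels against the same factor of \<open>sqrt (m * l)\<close>.\<close>

lemma D_norm_eq: "D_norm xs bs = ennreal_root m (\<Prod>i\<in>{1..m}. D_norm (fs i) hs)"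
proof -
  let ?P = "\<Prod>i\<in>{1..m}. Dq (fs i) hs"
  have nonneg: "0 \<le> Dq ys cs" for ys :: "'a list" and cs by (simp add: Dq_def)
  then have P: "0 \<le> ?P" by (intro prod_nonneg) blast
  have "root (m * l) (Dq xs bs) = sqrt (real m) * root (m * l) ?P"
    unfolding Dq_eq using n_pos by (simp add: real_root_mult real_root_power_cancel)
  then have "D_norm xs bs = ennreal (sqrt (real m) * sqrt (real l)) / ennreal (sqrt (real m) * root (m * l) ?P)"
    by (simp add: D_norm_def length_xs real_sqrt_mult)
  also have "\<dots> = ennreal (sqrt (real l)) / ennreal (root (m * l) ?P)"
    using m_pos l_pos P by (intro ennreal_divide_cancel_real) (auto intro: real_root_ge_zero)
  also have "\<dots> = ennreal_root (card {1..m}) (\<Prod>i\<in>{1..m}. ennreal (sqrt (real l)) / ennreal (root l (Dq (fs i) hs)))"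
    using ennreal_root_prod_divide[of "{1..m}" l "\<lambda>i. Dq (fs i) hs" "sqrt (real l)"] m_pos l_pos nonneg
    by simp
  also have "(\<Prod>i\<in>{1..m}. ennreal (sqrt (real l)) / ennreal (root l (Dq (fs i) hs)))
    = (\<Prod>i\<in>{1..m}. D_norm (fs i) hs)"
    by (intro prod.cong) (simp_all add: D_norm_def length_fs)
  finally show ?thesis by simp
qed

text \<open>For one coset each factor is at most its maximum. The two maxima may occur at different
  cosets, so this argument gives only an inequality.\<close>

lemma rho_le:
  "(MAX i\<in>{1..m}. rho (fs i) hs) \<le> (MAX i\<in>{1..m}. L_norm (fs i) hs) * (MAX i\<in>{1..m}. U_norm (fs i) hs)"
proof (rule Max.boundedI)
  fix y assume "y \<in> (\<lambda>i. rho (fs i) hs) ` {1..m}"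
  then obtain i where i: "i \<in> {1..m}" "y = rho (fs i) hs" by blast
  have "fs i \<noteq> []" using length_fs[OF i(1)] l_pos by auto
  then have "y = L_norm (fs i) hs * U_norm (fs i) hs" using i rho_eq_L_norm_U_norm by blast
  also have "\<dots> \<le> (MAX i\<in>{1..m}. L_norm (fs i) hs) * (MAX i\<in>{1..m}. U_norm (fs i) hs)"
    using i(1) by (intro mult_mono) (auto intro: Max_ge)
  finally show "y \<le> (MAX i\<in>{1..m}. L_norm (fs i) hs) * (MAX i\<in>{1..m}. U_norm (fs i) hs)" .
qed (use m_pos in auto)

lemma rho_eq:
  "rho xs bs = (MAX i\<in>{1..m}. L_norm (fs i) hs) * (MAX i\<in>{1..m}. U_norm (fs i) hs)"
  using rho_eq_L_norm_U_norm[of xs bs] length_xs n_pos by (simp add: L_norm_eq U_norm_eq flip: length_0_conv)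

end

theorem theorem6p8:
  fixes G :: "('a, 'b) monoid_scheme"
    and H E :: "'a set"
    and k :: "nat \<Rightarrow> 'a set"
    and g :: "nat \<Rightarrow> 'a"
    and m l :: nat
    and B\<^sub>H B :: "('a \<Rightarrow> complex) set"
    and ext :: "('a \<Rightarrow> complex) \<Rightarrow> ('a \<Rightarrow> complex)"
    and F F' :: "nat \<Rightarrow> 'a set"
    and xs :: "'a list" and bs hs :: "('a \<Rightarrow> complex) list" and fs :: "nat \<Rightarrow> 'a list"
  assumes "comm_group G" and "finite (carrier G)"
    and "subgroup H G"
    and "bij_betw k {1..m} (rcosets\<^bsub>G\<^esub> H)"
    and "E \<subseteq> carrier G" and "E \<noteq> {}"
    and "\<And>i. i \<in> {1..m} \<Longrightarrow> F i = E \<inter> k i"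
    and "\<And>i. i \<in> {1..m} \<Longrightarrow> card (F i) = l"
    and "\<And>i. i \<in> {1..m} \<Longrightarrow> g i \<in> k i"
    and "\<And>i. i \<in> {1..m} \<Longrightarrow> F' i = F i #>\<^bsub>G\<^esub> inv\<^bsub>G\<^esub> (g i)"
    and "B\<^sub>H \<subseteq> characters (G\<lparr>carrier := H\<rparr>)" and "card B\<^sub>H = l"
    and "\<And>\<phi>. \<phi> \<in> B\<^sub>H \<Longrightarrow> ext \<phi> \<in> characters G \<and> restrict (ext \<phi>) H = \<phi>"
    and "B = {char_mult G (ext \<phi>) \<psi> | \<phi> \<psi>. \<phi> \<in> B\<^sub>H \<and> \<psi> \<in> annihilator G H}"
    and "enumerates xs E" and "enumerates bs B" and "enumerates hs B\<^sub>H"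
    and "\<And>i. i \<in> {1..m} \<Longrightarrow> enumerates (fs i) (F' i)"
  shows "L_norm xs bs = (MAX i\<in>{1..m}. L_norm (fs i) hs)
    \<and> U_norm xs bs = (MAX i\<in>{1..m}. U_norm (fs i) hs)
    \<and> rho xs bs = (MAX i\<in>{1..m}. L_norm (fs i) hs) * (MAX i\<in>{1..m}. U_norm (fs i) hs)
    \<and> (MAX i\<in>{1..m}. L_norm (fs i) hs) * (MAX i\<in>{1..m}. U_norm (fs i) hs)
          \<ge> (MAX i\<in>{1..m}. rho (fs i) hs)
    \<and> D_norm xs bs = ennreal_root m (\<Prod>i\<in>{1..m}. D_norm (fs i) hs)"
proof -
  interpret multi_tiling G H E k g m l B\<^sub>H B ext F F' xs bs hs fs
    by (intro multi_tiling.intro multi_tiling_axioms.intro) (fact assms)+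
  show ?thesis using L_norm_eq U_norm_eq rho_eq rho_le D_norm_eq by blast
qed

end
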